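(* If the initial data $u_0$ is real analytic on $\mathbb{T}$, then there exist $\varepsilon>0$ and a unique solution $u(x,t)$ to the Cauchy problem for the Fornberg--Whitham equation $$u_t+\tfrac32uu_x=(1-\partial_x^2)^{-1}\partial_xu,\qquad u(x,0)=u_0(x),$$ that is analytic in both $x$ and $t$, for $x\in\mathbb{T}$ and all $t\in(-\varepsilon,\varepsilon)$.
   Context: $\mathbb{T}$ is the circle $\mathbb{R}/2\pi\mathbb{Z}$. The operator $(1-\partial_x^2)^{-1}$ is the Fourier multiplier on $\mathbb{T}$ with symbol $1/(1+\xi^2)$, $\xi\in\mathbb{Z}$. *)

theory Defs
  imports "HOL-Analysis.Analysis"
begin

definition real_analytic_at :: "(real \<Rightarrow> real) \<Rightarrow> real \<Rightarrow> bool" where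
  "real_analytic_at f x0 \<longleftrightarrow>
     (\<exists>(a :: nat \<Rightarrow> real) r. r > 0 \<and>
        (\<forall>x. \<bar>x - x0\<bar> < r \<longrightarrow> (\<lambda>n. a n * (x - x0) ^ n) sums f x))"

text \<open>
  Joint analyticity. The double series is summed unconditionally, which for real terms
  means absolutely, so no order of summation has to be chosen.
\<close>

definition real_analytic2_at :: "(real \<Rightarrow> real \<Rightarrow> real) \<Rightarrow> real \<Rightarrow> real \<Rightarrow> bool" where
  "real_analytic2_at u x0 t0 \<longleftrightarrow>
     (\<exists>(a :: nat \<Rightarrow> nat \<Rightarrow> real) r. r > 0 \<and>
        (\<forall>x t. \<bar>x - x0\<bar> < r \<longrightarrow> \<bar>t - t0\<bar> < r \<longrightarrow>
           ((\<lambda>(m, n). a m n * (x - x0) ^ m * (t - t0) ^ n) has_sum u x t) UNIV))"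

text \<open>
  Functions on the circle \<open>\<real>/2\<pi>\<int>\<close> are represented by \<open>2\<pi>\<close>-periodic functions on the real line.
\<close>

definition periodic_2pi :: "(real \<Rightarrow> 'a) \<Rightarrow> bool" where
  "periodic_2pi f \<longleftrightarrow> (\<forall>x. f (x + 2 * pi) = f x)"

definition fourier_coeff :: "(real \<Rightarrow> complex) \<Rightarrow> int \<Rightarrow> complex" where
  "fourier_coeff f k =
     integral {0..2 * pi} (\<lambda>x. f x * cis (- (of_int k * x))) / (2 * of_real pi)"

definition fourier_multiplier :: "(int \<Rightarrow> complex) \<Rightarrow> (real \<Rightarrow> complex) \<Rightarrow> real \<Rightarrow> complex" where
  "fourier_multiplier \<sigma> f x = (\<Sum>\<^sub>\<infinity>k\<in>UNIV. \<sigma> k * fourier_coeff f k * cis (of_int k * x))"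

text \<open>The operator \<open>(1 - \<partial>\<^sub>x\<^sup>2)\<^sup>-\<^sup>1\<close>.\<close>

definition inv_helmholtz :: "(real \<Rightarrow> complex) \<Rightarrow> real \<Rightarrow> complex" where
  "inv_helmholtz = fourier_multiplier (\<lambda>\<xi>. 1 / (1 + (of_int \<xi>)\<^sup>2))"

text \<open>
  The Fornberg--Whitham equation at the point \<open>(x, t)\<close>. It is an equation between complex
  numbers only because \<^const>\<open>inv_helmholtz\<close> acts on complex-valued functions; \<open>u\<close> is real.
\<close>

definition FW_equation_at :: "(real \<Rightarrow> real \<Rightarrow> real) \<Rightarrow> real \<Rightarrow> real \<Rightarrow> bool" where
  "FW_equation_at u x t \<longleftrightarrow>
     complex_of_real (deriv (\<lambda>s. u x s) t + 3 / 2 * u x t * deriv (\<lambda>y. u y t) x)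
       = inv_helmholtz (\<lambda>z. complex_of_real (deriv (\<lambda>y. u y t) z)) x"

definition analytic_FW_solution ::
    "(real \<Rightarrow> real) \<Rightarrow> real \<Rightarrow> (real \<Rightarrow> real \<Rightarrow> real) \<Rightarrow> bool" where
  "analytic_FW_solution u0 \<epsilon> u \<longleftrightarrow>
     (\<forall>t\<in>{-\<epsilon><..<\<epsilon>}. periodic_2pi (\<lambda>x. u x t)) \<and>
     (\<forall>x. \<forall>t\<in>{-\<epsilon><..<\<epsilon>}. real_analytic2_at u x t) \<and>
     (\<forall>x. \<forall>t\<in>{-\<epsilon><..<\<epsilon>}. FW_equation_at u x t) \<and>
     (\<forall>x. u x 0 = u0 x)"

end

theory Submission
  imports Defs
begin

text \<open>
  Existence: write \<open>u (x, t) = \<Sum>\<^sub>n u\<^sub>n(x) t\<^sup>n\<close>; the equation determines \<open>u\<^sub>n\<close> recursively from \<open>u\<^sub>0\<close>.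
  Since \<open>1 - \<partial>\<^sup>2 = (1 - \<partial>)(1 + \<partial>)\<close>, two applications of the maximum principle to first order
  equations show that \<open>(1 - \<partial>\<^sup>2)\<^sup>-\<^sup>1\<close> does not increase the supremum norm, and it commutes with
  \<open>\<partial>\<close>. The nonlocal term is therefore majorised by \<open>\<partial>u\<close>, and the method of majorants applies as in
  the Cauchy--Kovalevskaya theorem: the Taylor coefficients of \<open>u\<^sub>n\<close> are dominated by those of
  \<open>A \<Phi>(R x + B t)\<close> with \<open>\<Phi>(s) = \<Sum>\<^sub>k s\<^sup>k / (k + 1)\<^sup>2\<close>, because \<open>\<Phi>\<^sup>2\<close> is majorised by \<open>8 \<Phi>\<close>.

  Uniqueness is an energy estimate: for two solutions \<open>u\<close>, \<open>v\<close> the integral of \<open>(u - v)\<^sup>2\<close> over a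
  period satisfies a linear differential inequality in \<open>t\<close>, the nonlocal operator being antisymmetric.
\<close>

section \<open>The Helmholtz equation for periodic functions\<close>

text \<open>The operator is given as an unconditional sum of Fourier modes, which shows neither a
  sup bound nor a commutation with derivatives at a glance. It is therefore identified, on
  continuous periodic data, with the solution map of h - h'' = f, and every later estimate uses that
  equation alone.

  The obstacle in the recursion is the loss of a derivative: level n + 1 at order j uses level n at
  order j + 1 and carries the factor (j + 1) / (n + 1). A majorant depending only on the combination
  R x + B t pays for it exactly. Its coefficients contain the binomial
  \<open>n + j choose j\<close>, and (j + 1) * (n + j + 1 choose j + 1) = (n + 1) * (n + j + 1
  choose j), so the growing factor j + 1 is traded for n + 1, which the division removes.
  Vandermonde's identity keeps products of two such coefficient families within the same form, so
  the quadratic term costs only a constant.\<close>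

lemma periodic_2pi_of_int:
  assumes "periodic_2pi f"
  shows "f (x + 2 * pi * of_int k) = f x"
proof -
  have nat: "f (x + 2 * pi * of_nat n) = f x" for n :: nat and x
  proof (induction n)
    case (Suc n)
    have "f (x + 2 * pi * of_nat (Suc n)) = f ((x + 2 * pi * of_nat n) + 2 * pi)"
      by (simp add: algebra_simps)
    also have "\<dots> = f x"
      using assms Suc unfolding periodic_2pi_def by metis
    finally show ?case .
  qed simp
  show ?thesis
  proof (cases "k \<ge> 0")
    case True
    then show ?thesis using nat[of x "nat k"] by simp
  next
    case False
    then show ?thesis using nat[of "x + 2 * pi * of_int k" "nat (-k)"] by simp
  qed
qed

lemma periodic_2pi_reduce:
  assumes "periodic_2pi f"
  obtains y where "0 \<le> y" "y \<le> 2 * pi" "f y = f x"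
proof
  define k where "k = \<lfloor>x / (2 * pi)\<rfloor>"
  have k: "of_int k \<le> x / (2 * pi)" "x / (2 * pi) < of_int k + 1"
    unfolding k_def by linarith+
  show "0 \<le> x + 2 * pi * of_int (- k)" "x + 2 * pi * of_int (- k) \<le> 2 * pi"
    using k by (simp_all add: field_simps)
  show "f (x + 2 * pi * of_int (- k)) = f x"
    using assms by (rule periodic_2pi_of_int)
qed

lemma periodic_2pi_deriv:
  fixes f f' :: "real \<Rightarrow> real"
  assumes "periodic_2pi f" and "\<And>x. (f has_real_derivative f' x) (at x)"
  shows "periodic_2pi f'"
  unfolding periodic_2pi_def
proof
  fix x
  have "((\<lambda>x. f (x + 2 * pi)) has_real_derivative f' (x + 2 * pi)) (at x)"
    using assms(2)[of "x + 2 * pi"] by (simp add: DERIV_shift)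
  moreover have "(\<lambda>x. f (x + 2 * pi)) = f"
    using assms(1) by (auto simp: periodic_2pi_def)
  ultimately show "f' (x + 2 * pi) = f' x"
    using assms(2) DERIV_unique by metis
qed

lemma periodic_2pi_bounded:
  fixes f :: "real \<Rightarrow> 'a :: real_normed_vector"
  assumes "periodic_2pi f" and "continuous_on UNIV f"
  obtains M where "\<And>x. norm (f x) \<le> M"
proof -
  have "compact (f ` {0..2 * pi})"
    by (intro compact_continuous_image continuous_on_subset[OF assms(2)]) auto
  then obtain M where M: "\<And>x. x \<in> {0..2 * pi} \<Longrightarrow> norm (f x) \<le> M"
    using compact_imp_bounded bounded_iff by (metis imageI)
  have "norm (f x) \<le> M" for x
    by (rule periodic_2pi_reduce[OF assms(1), of x]) (metis M atLeastAtMost_iff)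
  then show ?thesis using that by blast
qed

text \<open>At an extremum of \<open>w\<close> the derivative vanishes, so \<open>w\<close> agrees there with \<open>w + \<sigma> w'\<close>.\<close>

lemma periodic_first_order_bound:
  fixes w w' :: "real \<Rightarrow> real"
  assumes per: "periodic_2pi w" and der: "\<And>x. (w has_real_derivative w' x) (at x)"
    and le: "\<And>x. \<bar>w x + \<sigma> * w' x\<bar> \<le> M"
  shows "\<bar>w x\<bar> \<le> M"
proof -
  have upper: "v x \<le> M" if per: "periodic_2pi v" and der: "\<And>x. (v has_real_derivative v' x) (at x)"
    and le: "\<And>x. v x + \<sigma> * v' x \<le> M" for v v' :: "real \<Rightarrow> real" and x
  proof -
    have "continuous_on {0..2 * pi} v"
      using der by (meson DERIV_isCont continuous_at_imp_continuous_on)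
    then obtain z where z: "\<forall>y\<in>{0..2 * pi}. v y \<le> v z"
      using continuous_attains_sup[of "{0..2 * pi}" v] by force
    have z: "v y \<le> v z" for y
      by (rule periodic_2pi_reduce[OF per, of y]) (metis z atLeastAtMost_iff)
    have "v' z = 0"
      using DERIV_local_max[OF der[of z], of 1] z by simp
    then show ?thesis using z[of x] le[of z] by simp
  qed
  have "w x \<le> M"
    by (rule upper[OF per der]) (use le in \<open>auto simp: abs_le_iff\<close>)
  moreover have "- w x \<le> M"
  proof (rule upper[where v = "\<lambda>x. - w x" and v' = "\<lambda>x. - w' x"])
    show "periodic_2pi (\<lambda>x. - w x)"
      using per by (simp add: periodic_2pi_def)
    show "((\<lambda>x. - w x) has_real_derivative - w' x) (at x)" for x
      by (intro DERIV_minus der)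
    show "- w x + \<sigma> * - w' x \<le> M" for x
      using le[of x] by (simp add: abs_le_iff)
  qed
  ultimately show ?thesis by simp
qed

text \<open>Variation of constants: the solutions of w + w' = f are exp (- x) * (K + G x) with
  \<open>G\<close> an antiderivative of exp x * f x. Periodicity determines the constant.\<close>

lemma periodic_first_order_exists:
  fixes f :: "real \<Rightarrow> real"
  assumes per: "periodic_2pi f" and cont: "continuous_on UNIV f"
  obtains w where "periodic_2pi w" "\<And>x. (w has_real_derivative f x - w x) (at x)"
proof -
  have "\<exists>G. \<forall>x::real. -\<infinity> < ereal x \<longrightarrow> ereal x < \<infinity> \<longrightarrow>
          (G has_vector_derivative exp x * f x) (at x)"
    by (rule einterval_antiderivative)
       (use cont in \<open>auto intro!: continuous_intros simp: continuous_on_eq_continuous_at\<close>)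
  then obtain G where G: "\<And>x. (G has_real_derivative exp x * f x) (at x)"
    by (auto simp: has_real_derivative_iff_has_vector_derivative)
  define D where "D x = G (x + 2 * pi) - exp (2 * pi) * G x" for x
  have "(D has_real_derivative 0) (at x)" for x
  proof -
    have "((\<lambda>x. G (x + 2 * pi)) has_real_derivative exp (x + 2 * pi) * f (x + 2 * pi)) (at x)"
      using G[of "x + 2 * pi"] by (simp add: DERIV_shift)
    then have "(D has_real_derivative
        exp (x + 2 * pi) * f (x + 2 * pi) - exp (2 * pi) * (exp x * f x)) (at x)"
      unfolding D_def by (intro DERIV_diff DERIV_cmult G)
    then show ?thesis
      using per by (simp add: periodic_2pi_def exp_add)
  qed
  then have D: "D x = D 0" for x
    using DERIV_isconst_all by blast
  \<comment> \<open>Periodicity of \<open>w\<close> means K + G (x + 2 pi) = exp (2 pi) * (K + G x),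
    that is, D x = K * (exp (2 pi) - 1); this can be solved because \<open>D\<close> is
    constant.\<close>
  define K where "K = D 0 / (exp (2 * pi) - 1)"
  have K: "D 0 = K * (exp (2 * pi) - 1)"
    unfolding K_def by simp
  define w where "w x = exp (- x) * (K + G x)" for x
  have "w (x + 2 * pi) = w x" for x
  proof -
    have "K + G (x + 2 * pi) = exp (2 * pi) * (K + G x)"
      using D[of x] K by (simp add: D_def algebra_simps)
    then have "w (x + 2 * pi) = exp (- (x + 2 * pi)) * (exp (2 * pi) * (K + G x))"
      unfolding w_def by simp
    also have "\<dots> = exp (- (x + 2 * pi) + 2 * pi) * (K + G x)"
      by (simp only: exp_add mult.assoc)
    finally show ?thesis by (simp add: w_def)
  qed
  moreover have "(w has_real_derivative f x - w x) (at x)" for x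
  proof -
    have "(w has_real_derivative exp (- x) * (- 1) * (K + G x) + exp (- x) * (exp x * f x)) (at x)"
      unfolding w_def
      by (auto intro!: derivative_eq_intros G simp: algebra_simps)
    moreover have "exp (- x) * (exp x * f x) = f x"
      by (simp add: exp_minus)
    ultimately show ?thesis by (simp add: w_def)
  qed
  ultimately show ?thesis using that unfolding periodic_2pi_def by blast
qed

text \<open>Encodes h - h'' = f as a first order system, so that both derivatives are explicit
  functions.\<close>

definition helmholtz_pair :: "(real \<Rightarrow> real) \<Rightarrow> (real \<Rightarrow> real) \<Rightarrow> (real \<Rightarrow> real) \<Rightarrow> bool" where
  "helmholtz_pair f h h' \<longleftrightarrow> periodic_2pi f \<and> continuous_on UNIV f \<and> periodic_2pi h \<and>
     (\<forall>x. (h has_real_derivative h' x) (at x)) \<and>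
     (\<forall>x. (h' has_real_derivative h x - f x) (at x))"

text \<open>The two first order factors are inverted in turn: w + w' = f, then h - h' = w. The
  reflection x -> -x brings the second equation into the form of the first.\<close>

lemma helmholtz_pair_exists:
  assumes per: "periodic_2pi f" and cont: "continuous_on UNIV f"
  shows "\<exists>h h'. helmholtz_pair f h h'"
proof -
  obtain w where w: "periodic_2pi w" "\<And>x. (w has_real_derivative f x - w x) (at x)"
    using periodic_first_order_exists[OF assms] by blast
  have wc: "continuous_on UNIV w"
    using w(2) by (meson DERIV_isCont continuous_at_imp_continuous_on)
  define r where "r x = w (- x)" for x
  have "periodic_2pi r"
    unfolding periodic_2pi_def r_def
  proof
    fix x show "w (- (x + 2 * pi)) = w (- x)"
      using periodic_2pi_of_int[OF w(1), of "- x" "-1"] by simp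
  qed
  moreover have "continuous_on UNIV r"
    unfolding r_def by (intro continuous_on_compose2[OF wc] continuous_intros) auto
  ultimately obtain v where v: "periodic_2pi v" "\<And>x. (v has_real_derivative r x - v x) (at x)"
    using periodic_first_order_exists by blast
  define h where "h x = v (- x)" for x
  have hper: "periodic_2pi h"
    unfolding periodic_2pi_def h_def
  proof
    fix x show "v (- (x + 2 * pi)) = v (- x)"
      using periodic_2pi_of_int[OF v(1), of "- x" "-1"] by simp
  qed
  have h: "(h has_real_derivative h x - w x) (at x)" for x
  proof -
    have "(h has_real_derivative (r (- x) - v (- x)) * (- 1)) (at x)"
      unfolding h_def by (rule DERIV_chain2[where f = v, OF v(2)]) (auto intro!: derivative_eq_intros)
    then show ?thesis by (simp add: h_def r_def)
  qed
  have "((\<lambda>x. h x - w x) has_real_derivative (h x - f x)) (at x)" for x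
    using DERIV_diff[OF h w(2), of x] by simp
  then have "helmholtz_pair f h (\<lambda>x. h x - w x)"
    unfolding helmholtz_pair_def using assms hper h by auto
  then show ?thesis by blast
qed

lemma helmholtz_pair_periodic_deriv:
  "helmholtz_pair f h h' \<Longrightarrow> periodic_2pi h'"
  unfolding helmholtz_pair_def using periodic_2pi_deriv by blast

lemma helmholtz_pair_bound:
  assumes hp: "helmholtz_pair f h h'" and le: "\<And>x. \<bar>f x\<bar> \<le> M"
  shows "\<bar>h x\<bar> \<le> M"
proof (rule periodic_first_order_bound[where \<sigma> = 1 and w = h and w' = h'])
  show "periodic_2pi h"
    using hp by (auto simp: helmholtz_pair_def)
  show d: "(h has_real_derivative h' x) (at x)" for x
    using hp by (auto simp: helmholtz_pair_def)
  have d': "\<And>x. (h' has_real_derivative h x - f x) (at x)"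
    using hp by (auto simp: helmholtz_pair_def)
  fix x
  \<comment> \<open>With p = h + h' the equation reads p - p' = f, hence sigma = -1 here; the
    enclosing application, to h + h' = p, has sigma = 1.\<close>
  have "\<bar>h x + h' x\<bar> \<le> M"
  proof (rule periodic_first_order_bound[where \<sigma> = "-1" and w = "\<lambda>x. h x + h' x" and w' = "\<lambda>x. h' x + (h x - f x)"])
    show "periodic_2pi (\<lambda>x. h x + h' x)"
      using hp helmholtz_pair_periodic_deriv[OF hp] by (auto simp: helmholtz_pair_def periodic_2pi_def)
    show "((\<lambda>x. h x + h' x) has_real_derivative h' x + (h x - f x)) (at x)" for x
      by (intro DERIV_add d d')
    show "\<bar>h x + h' x + - 1 * (h' x + (h x - f x))\<bar> \<le> M" for x
      using le[of x] by simp
  qed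
  then show "\<bar>h x + 1 * h' x\<bar> \<le> M" by simp
qed

lemma helmholtz_pair_lincomb:
  assumes "helmholtz_pair f h h'" "helmholtz_pair g k k'"
  shows "helmholtz_pair (\<lambda>x. a * f x + b * g x) (\<lambda>x. a * h x + b * k x) (\<lambda>x. a * h' x + b * k' x)"
  using assms unfolding helmholtz_pair_def
  by (auto intro!: derivative_eq_intros continuous_intros simp: periodic_2pi_def algebra_simps)

text \<open>The difference of two solutions has datum 0, and the sup bound with M = 0 makes it
  vanish.\<close>

lemma helmholtz_pair_unique:
  assumes "helmholtz_pair f h h'" "helmholtz_pair f k k'"
  shows "h = k"
proof
  fix x
  have "\<bar>1 * h x + (-1) * k x\<bar> \<le> 0"
    by (rule helmholtz_pair_bound[OF helmholtz_pair_lincomb[OF assms]]) simp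
  then show "h x = k x" by simp
qed

text \<open>Commutation of the solution map with differentiation: the second derivative of
  \<open>h\<close> is h - f, whose own derivative is h' - f'.\<close>

lemma helmholtz_pair_deriv:
  assumes hp: "helmholtz_pair f h h'" and f: "\<And>x. (f has_real_derivative f' x) (at x)"
    and f': "continuous_on UNIV f'"
  shows "helmholtz_pair f' h' (\<lambda>x. h x - f x)"
  using assms helmholtz_pair_periodic_deriv[OF hp] periodic_2pi_deriv[OF _ f]
  unfolding helmholtz_pair_def by (auto intro!: DERIV_diff)

section \<open>Fourier inversion\<close>

lemma fourier_integrand_integrable:
  fixes f :: "real \<Rightarrow> complex"
  assumes "continuous_on UNIV f"
  shows "(\<lambda>x. f x * cis (- (of_int k * x))) integrable_on {a..b}"
  by (intro integrable_continuous_interval continuous_intros continuous_on_subset[OF assms]) auto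

lemma fourier_coeff_diff:
  assumes "continuous_on UNIV f" "continuous_on UNIV g"
  shows "fourier_coeff (\<lambda>x. f x - g x) k = fourier_coeff f k - fourier_coeff g k"
  using assms unfolding fourier_coeff_def
  by (simp add: left_diff_distrib diff_divide_distrib Henstock_Kurzweil_Integration.integral_diff
      fourier_integrand_integrable)

lemma fourier_coeff_bound:
  assumes "continuous_on UNIV f" "\<And>x. norm (f x) \<le> M"
  shows "norm (fourier_coeff f k) \<le> M"
proof -
  have "norm (integral {0..2 * pi} (\<lambda>x. f x * cis (- (of_int k * x)))) \<le> M * (2 * pi - 0)"
    using assms(2)
    by (intro integral_bound continuous_intros continuous_on_subset[OF assms(1)])
       (auto simp: norm_mult)
  then show ?thesis
    unfolding fourier_coeff_def by (simp add: norm_divide norm_mult field_simps)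
qed

text \<open>The shifted integral is the increment G (c + 2 pi) - G c of an antiderivative, and this
  increment is constant in \<open>c\<close> since its derivative vanishes by periodicity.\<close>

lemma integral_periodic_shift:
  fixes f :: "real \<Rightarrow> complex"
  assumes per: "periodic_2pi f" and cont: "continuous_on UNIV f"
  shows "integral {0..2 * pi} (\<lambda>y. f (c + y)) = integral {0..2 * pi} f"
proof -
  have "\<exists>G. \<forall>x::real. -\<infinity> < ereal x \<longrightarrow> ereal x < \<infinity> \<longrightarrow> (G has_vector_derivative f x) (at x)"
    by (rule einterval_antiderivative) (use cont in \<open>auto simp: continuous_on_eq_continuous_at\<close>)
  then obtain G where G: "\<And>x. (G has_vector_derivative f x) (at x)"
    by auto
  have shift: "((\<lambda>x. G (c + x)) has_vector_derivative f (c + x)) (at x)" for c x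
  proof -
    have "((G \<circ> (\<lambda>x. c + x)) has_vector_derivative 1 *\<^sub>R f (c + x)) (at x)"
      by (rule vector_diff_chain_at) (auto intro!: derivative_eq_intros G)
    then show ?thesis by (simp add: o_def)
  qed
  have "((\<lambda>x. G (2 * pi + x) - G x) has_vector_derivative f (2 * pi + x) - f x) (at x)" for x
    by (intro has_vector_derivative_diff shift G)
  then have "((\<lambda>x. G (2 * pi + x) - G x) has_vector_derivative 0) (at x)" for x
    using per by (simp add: periodic_2pi_def add.commute)
  then obtain K where K: "\<And>x. G (2 * pi + x) - G x = K"
    using has_vector_derivative_zero_constant[of UNIV "\<lambda>x. G (2 * pi + x) - G x"] by auto
  have "((\<lambda>x. f (c + x)) has_integral (G (c + 2 * pi) - G (c + 0))) {0..2 * pi}" for c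
    using shift by (intro fundamental_theorem_of_calculus) (auto intro: has_vector_derivative_at_within)
  then have "((\<lambda>x. f (c + x)) has_integral K) {0..2 * pi}" for c
    using K[of c] by (metis add.commute add_0_right)
  from integral_unique[OF this] integral_unique[OF this[of 0]] show ?thesis
    by simp
qed

lemma cis_of_int_2pi: "cis (2 * pi * of_int k) = 1"
  by (simp add: complex_eq_iff)

lemma periodic_2pi_cis: "periodic_2pi (\<lambda>x. cis (of_int k * x))"
  unfolding periodic_2pi_def
proof
  fix x
  have "cis (of_int k * (x + 2 * pi)) = cis (of_int k * x) * cis (2 * pi * of_int k)"
    by (simp add: cis_mult algebra_simps)
  then show "cis (of_int k * (x + 2 * pi)) = cis (of_int k * x)"
    by (simp only: cis_of_int_2pi mult_1_right)
qed

text \<open>Two uses matter: c = pi / k, where the factor is -1, yields decay of the coefficients,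
  and c = x moves the point of Fourier inversion to the origin.\<close>

lemma fourier_coeff_shift:
  assumes per: "periodic_2pi f" and cont: "continuous_on UNIV f"
  shows "fourier_coeff (\<lambda>y. f (c + y)) k = cis (of_int k * c) * fourier_coeff f k"
proof -
  let ?F = "\<lambda>y. f y * cis (- (of_int k * y))"
  have "periodic_2pi ?F"
    using per periodic_2pi_cis[of "- k"] unfolding periodic_2pi_def by simp
  moreover have "continuous_on UNIV ?F"
    by (intro continuous_intros cont)
  ultimately have eq: "integral {0..2 * pi} (\<lambda>y. ?F (c + y)) = integral {0..2 * pi} ?F"
    by (rule integral_periodic_shift)
  have shift: "f (c + y) * cis (- (of_int k * y)) = cis (of_int k * c) * ?F (c + y)" for y
    by (simp add: cis_mult algebra_simps)
  have "integral {0..2 * pi} (\<lambda>y. f (c + y) * cis (- (of_int k * y))) =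
      integral {0..2 * pi} (\<lambda>y. cis (of_int k * c) * ?F (c + y))"
    by (simp only: shift)
  also have "\<dots> = cis (of_int k * c) * integral {0..2 * pi} (\<lambda>y. ?F (c + y))"
    by (rule integral_mult_right)
  finally show ?thesis
    unfolding fourier_coeff_def eq by simp
qed

lemma fourier_coeff_mult_cis:
  "fourier_coeff (\<lambda>y. f y * cis y) k = fourier_coeff f (k - 1)"
proof -
  have "f y * cis y * cis (- (of_int k * y)) = f y * cis (- (of_int (k - 1) * y))" for y
    by (simp add: cis_mult mult.assoc algebra_simps)
  then show ?thesis
    unfolding fourier_coeff_def by (simp only:)
qed

lemma fourier_coeff_const: "fourier_coeff (\<lambda>y. c) k = (if k = 0 then c else 0)"
proof (cases "k = 0")
  case True
  then show ?thesis by (simp add: fourier_coeff_def scaleR_conv_of_real)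
next
  case False
  text \<open>Shift by half a period of \<open>cis (k y)\<close>.\<close>
  have "fourier_coeff (\<lambda>y. c) k = cis (of_int k * (pi / of_int k)) * fourier_coeff (\<lambda>y. c) k"
    using fourier_coeff_shift[of "\<lambda>y. c" "pi / of_int k" k] by (simp add: periodic_2pi_def)
  then show ?thesis using False by simp
qed

text \<open>Translation by c = pi / k negates the k-th coefficient, so twice that coefficient
  belongs to q y - q (c + y), which is uniformly small.\<close>

lemma riemann_lebesgue_periodic:
  assumes per: "periodic_2pi q" and cont: "continuous_on UNIV q" and e: "e > 0"
  shows "\<exists>K>0. \<forall>k. \<bar>of_int k\<bar> \<ge> (K::real) \<longrightarrow> norm (fourier_coeff q k) \<le> e"
proof -
  \<comment> \<open>This interval contains z and c + z for every z in one period [0, 2 pi], as long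
    as |c| \<le> pi.\<close>
  have "uniformly_continuous_on {-pi..3 * pi} q"
    by (intro compact_uniformly_continuous continuous_on_subset[OF cont]) auto
  then obtain d where d: "d > 0"
    "\<And>x y. \<lbrakk>x \<in> {-pi..3 * pi}; y \<in> {-pi..3 * pi}; dist y x < d\<rbrakk> \<Longrightarrow> dist (q y) (q x) < e"
    using e unfolding uniformly_continuous_on_def by metis
  \<comment> \<open>The 1 keeps |pi / k| \<le> pi; the other entry gives |pi / k| \<le> d / 2 <
    d.\<close>
  define K where "K = max 1 (2 * pi / d)"
  have "norm (fourier_coeff q k) \<le> e" if k: "\<bar>of_int k\<bar> \<ge> K" for k
  proof -
    define c where "c = pi / of_int k"
    have k0: "\<bar>of_int k :: real\<bar> \<ge> 1" "\<bar>of_int k\<bar> \<ge> 2 * pi / d"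
      using k unfolding K_def by auto
    have c1: "\<bar>c\<bar> \<le> pi"
      using k0(1) by (simp add: c_def abs_divide field_simps)
    have c2: "\<bar>c\<bar> < d"
    proof -
      have "2 * pi \<le> \<bar>of_int k\<bar> * d"
        using k0(2) d(1) by (simp add: field_simps)
      then have "pi < \<bar>of_int k\<bar> * d"
        using pi_gt_zero by linarith
      moreover have "\<bar>c\<bar> = pi / \<bar>of_int k\<bar>" by (simp add: c_def abs_divide)
      ultimately show ?thesis
        using k0(1) by (simp add: pos_divide_less_eq mult.commute)
    qed
    have small: "norm (q y - q (c + y)) \<le> e" for y
    proof -
      have "periodic_2pi (\<lambda>y. q y - q (c + y))"
        using per by (simp add: periodic_2pi_def add.assoc[symmetric])
      then obtain z where z: "0 \<le> z" "z \<le> 2 * pi" "q z - q (c + z) = q y - q (c + y)"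
        by (rule periodic_2pi_reduce)
      have "dist (q z) (q (c + z)) < e"
        using z(1,2) c1 c2 by (intro d(2)) (auto simp: dist_norm abs_le_iff)
      then show ?thesis
        using z(3) by (simp add: dist_norm)
    qed
    have cont': "continuous_on UNIV (\<lambda>y. q (c + y))"
      by (intro continuous_on_compose2[OF cont] continuous_intros) auto
    have "cis (of_int k * c) = -1"
      using k0(1) by (auto simp: c_def)
    then have "fourier_coeff (\<lambda>y. q y - q (c + y)) k = 2 * fourier_coeff q k"
      using fourier_coeff_shift[OF per cont, of c k] fourier_coeff_diff[OF cont cont']
      by simp
    moreover have "norm (fourier_coeff (\<lambda>y. q y - q (c + y)) k) \<le> e"
      using small by (intro fourier_coeff_bound continuous_intros cont cont')
    ultimately have "2 * norm (fourier_coeff q k) \<le> e"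
      by (simp add: norm_mult)
    then show ?thesis using norm_ge_zero[of "fourier_coeff q k"] by linarith
  qed
  moreover have "K > 0" by (simp add: K_def)
  ultimately show ?thesis by blast
qed

lemma sum_int_telescope:
  fixes g :: "int \<Rightarrow> 'a :: ab_group_add"
  shows "(\<Sum>k\<in>{- int N..int N}. g (k - 1) - g k) = g (- 1 - int N) - g (int N)"
proof (induction N)
  case (Suc N)
  have "{- int (Suc N)..int (Suc N)} = insert (int (Suc N)) (insert (- int (Suc N)) {- int N..int N})"
    by auto
  then show ?case using Suc by (simp add: algebra_simps)
qed simp

text \<open>Chernoff's argument: the Fourier coefficients of \<open>h (x + y) - h x = q y (cis y - 1)\<close>
  telescope into those of the continuous function \<open>q\<close>.\<close>

lemma fourier_inversion:
  fixes h h' :: "real \<Rightarrow> real"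
  assumes per: "periodic_2pi h" and der: "\<And>x. (h has_real_derivative h' x) (at x)"
  shows "(\<lambda>N. \<Sum>k\<in>{- int N..int N}. fourier_coeff (\<lambda>z. of_real (h z)) k * cis (of_int k * x))
           \<longlonglongrightarrow> of_real (h x)"
proof -
  let ?h = "\<lambda>z. complex_of_real (h z)"
  \<comment> \<open>At the zeros of cis y - 1 the value is the limit h' x / \<i> of the quotient,
    which is what makes \<open>q\<close> continuous.\<close>
  define q where "q y = (if cis y = 1 then - \<i> * h' x else of_real (h (x + y) - h x) / (cis y - 1))" for y
  have hper: "periodic_2pi ?h"
    using per by (simp add: periodic_2pi_def)
  have hc: "continuous_on UNIV h"
    using der by (meson DERIV_isCont continuous_at_imp_continuous_on)
  have qper: "periodic_2pi q"
    using per periodic_2pi_cis[of 1] by (simp add: periodic_2pi_def q_def add.assoc[symmetric])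
  have cis1: "\<exists>k. y = 2 * pi * of_int k" if "cis y = 1" for y
  proof -
    have "cos y = 1" using that by (simp add: complex_eq_iff)
    then show ?thesis by (auto simp: cos_one_2pi_int)
  qed
  have qmult: "of_real (h (x + y) - h x) = q y * (cis y - 1)" for y
    using cis1[of y] periodic_2pi_of_int[OF per, of x] by (auto simp: q_def)
  have q0: "isCont q 0"
  proof -
    have "((\<lambda>y. (h (x + y) - h x) / y) \<longlongrightarrow> h' x) (at 0)"
      using der[of x] by (simp add: DERIV_def)
    then have "((\<lambda>y. complex_of_real ((h (x + y) - h x) / y)) \<longlongrightarrow> of_real (h' x)) (at 0)"
      by (intro tendsto_intros)
    moreover have "((\<lambda>y. (cis y - 1) / of_real y) \<longlongrightarrow> \<i>) (at 0)"
    proof -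
      have "((\<lambda>z. exp (\<i> * z)) has_field_derivative \<i>) (at 0)"
        by (auto intro!: derivative_eq_intros)
      then have "((\<lambda>z. (exp (\<i> * z) - 1) / z) \<longlongrightarrow> \<i>) (at 0)"
        by (simp add: DERIV_def)
      moreover have "filterlim complex_of_real (at 0) (at 0)"
        by (intro filterlim_atI tendsto_eq_intros) (auto simp: eventually_at_filter)
      ultimately show ?thesis
        unfolding cis_conv_exp by (rule filterlim_compose)
    qed
    ultimately have "((\<lambda>y. complex_of_real ((h (x + y) - h x) / y) / ((cis y - 1) / of_real y))
        \<longlongrightarrow> of_real (h' x) / \<i>) (at 0)"
      by (intro tendsto_divide) auto
    moreover have "\<forall>\<^sub>F y in at 0. complex_of_real ((h (x + y) - h x) / y) / ((cis y - 1) / of_real y) = q y"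
    proof -
      have "\<forall>\<^sub>F y in at (0::real). y \<in> ball 0 1 - {0}"
        using eventually_at_in_open[of "ball (0::real) 1" 0] by simp
      then show ?thesis
      proof eventually_elim
        case (elim y)
        have "cis y \<noteq> 1"
        proof
          assume "cis y = 1"
          then obtain k where k: "y = 2 * pi * of_int k" using cis1 by blast
          with elim have "k \<noteq> 0" by auto
          then have "1 \<le> \<bar>of_int k :: real\<bar>" by (simp flip: of_int_abs)
          then have "2 * pi * 1 \<le> 2 * pi * \<bar>of_int k\<bar>"
            by (intro mult_left_mono) auto
          then have "2 * pi \<le> \<bar>y\<bar>"
            using k by (simp add: abs_mult)
          then show False using elim pi_gt3 by (simp add: dist_norm)
        qed
        then show ?case using elim by (simp add: q_def field_simps)
      qed
    qed
    ultimately have "(q \<longlongrightarrow> of_real (h' x) / \<i>) (at 0)"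
      using tendsto_cong by force
    then show ?thesis
      by (simp add: isCont_def q_def)
  qed
  \<comment> \<open>The zeros of cis y - 1 are the multiples of 2 pi; continuity there is carried
    over from 0 by periodicity.\<close>
  have "isCont q y" for y
  proof (cases "cis y = 1")
    case True
    then obtain k where k: "y = 2 * pi * of_int k" using cis1 by blast
    have "isCont (\<lambda>z. q (z - y)) y"
      by (rule isCont_o2[where g = q]) (use q0 in \<open>auto intro!: continuous_intros\<close>)
    moreover have "(\<lambda>z. q (z - y)) = q"
    proof
      fix z show "q (z - y) = q z"
        using periodic_2pi_of_int[OF qper, of "z - y" k] k by simp
    qed
    ultimately show ?thesis by simp
  next
    case False
    have "isCont (\<lambda>y. h (x + y)) y"
      by (rule isCont_o2[where g = h and f = "\<lambda>y. x + y"]) (use hc in \<open>auto simp: continuous_on_eq_continuous_at\<close>)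
    moreover have "isCont cis y"
      using continuous_on_cis[OF continuous_on_id, of UNIV] by (simp add: continuous_on_eq_continuous_at)
    ultimately have "isCont (\<lambda>y. of_real (h (x + y) - h x) / (cis y - 1)) y"
      using False by (intro continuous_divide continuous_of_real continuous_diff continuous_const) auto
    moreover have "\<forall>\<^sub>F z in nhds y. cis z \<noteq> 1"
    proof -
      have "open {z. cis z \<noteq> 1}"
        by (rule open_Collect_neq[OF continuous_on_cis[OF continuous_on_id] continuous_on_const])
      then show ?thesis
        unfolding eventually_nhds using False by blast
    qed
    then have "\<forall>\<^sub>F z in nhds y. q z = of_real (h (x + z) - h x) / (cis z - 1)"
      by eventually_elim (simp add: q_def)
    ultimately show ?thesis
      using isCont_cong by force
  qed
  then have qc: "continuous_on UNIV q"
    by (simp add: continuous_on_eq_continuous_at)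
  have hc': "continuous_on UNIV ?h" "continuous_on UNIV (\<lambda>y. ?h (x + y))"
    by (intro continuous_on_of_real hc)
       (intro continuous_on_of_real continuous_on_compose2[OF hc] continuous_intros, auto)
  \<comment> \<open>Subtracting the constant \<open>h x\<close> affects only index 0, so the left
    side is the k-th coefficient of y -> h (x + y) - h x; multiplication by cis y in its
    factorisation shifts the index.\<close>
  have coeff: "fourier_coeff ?h k * cis (of_int k * x) - (if k = 0 then of_real (h x) else 0) =
      fourier_coeff q (k - 1) - fourier_coeff q k" for k
  proof -
    have "fourier_coeff (\<lambda>y. ?h (x + y) - of_real (h x)) k =
        fourier_coeff ?h k * cis (of_int k * x) - (if k = 0 then of_real (h x) else 0)"
      using fourier_coeff_shift[OF hper hc'(1), of x k]
      by (simp add: fourier_coeff_diff[OF hc'(2) continuous_on_const] fourier_coeff_const mult.commute)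
    moreover have "(\<lambda>y. ?h (x + y) - of_real (h x)) = (\<lambda>y. q y * cis y - q y)"
      using qmult by (auto simp: algebra_simps)
    ultimately show ?thesis
      by (simp add: fourier_coeff_diff fourier_coeff_mult_cis qc continuous_intros)
  qed
  have partial: "(\<Sum>k\<in>{- int N..int N}. fourier_coeff ?h k * cis (of_int k * x)) - of_real (h x) =
      fourier_coeff q (- 1 - int N) - fourier_coeff q (int N)" for N
  proof -
    have "(\<Sum>k\<in>{- int N..int N}. fourier_coeff ?h k * cis (of_int k * x)) - of_real (h x) =
        (\<Sum>k\<in>{- int N..int N}. fourier_coeff ?h k * cis (of_int k * x) - (if k = 0 then of_real (h x) else 0))"
      by (simp add: sum_subtractf)
    also have "\<dots> = (\<Sum>k\<in>{- int N..int N}. fourier_coeff q (k - 1) - fourier_coeff q k)"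
      by (intro sum.cong refl coeff)
    also have "\<dots> = fourier_coeff q (- 1 - int N) - fourier_coeff q (int N)"
      by (rule sum_int_telescope)
    finally show ?thesis .
  qed
  show ?thesis
  proof (rule LIMSEQ_I)
    fix e :: real assume "e > 0"
    then have "e / 3 > 0" by simp
    then obtain K where K: "K > 0" "\<And>k. \<bar>of_int k\<bar> \<ge> (K::real) \<Longrightarrow> norm (fourier_coeff q k) \<le> e / 3"
      using riemann_lebesgue_periodic[OF qper qc, of "e / 3"] by blast
    obtain M :: nat where M: "real M \<ge> K" using real_arch_simple by blast
    have "norm ((\<Sum>k\<in>{- int N..int N}. fourier_coeff ?h k * cis (of_int k * x)) - of_real (h x)) < e"
      if "N \<ge> M" for N
    proof -
      have "real N \<ge> K" using M that by linarith
      then have "norm (fourier_coeff q (- 1 - int N)) \<le> e / 3" "norm (fourier_coeff q (int N)) \<le> e / 3"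
        by (intro K(2); simp)+
      then show ?thesis
        unfolding partial
        using norm_triangle_ineq4[of "fourier_coeff q (- 1 - int N)" "fourier_coeff q (int N)"] \<open>e > 0\<close>
        by linarith
    qed
    then show "\<exists>M. \<forall>N\<ge>M. norm ((\<Sum>k\<in>{- int N..int N}. fourier_coeff ?h k * cis (of_int k * x)) - of_real (h x)) < e"
      by blast
  qed
qed

section \<open>The Fourier multiplier as the solution map of h - h'' = f\<close>

text \<open>Two integrations by parts at once: \<open>?G\<close> is an antiderivative of (1 + k^2) h
  e - f e, with e the k-th conjugate mode, and its boundary values cancel by periodicity.\<close>

lemma fourier_coeff_helmholtz:
  assumes hp: "helmholtz_pair f h h'"
  shows "fourier_coeff (\<lambda>z. of_real (h z)) k = 1 / (1 + (of_int k)\<^sup>2) * fourier_coeff (\<lambda>z. of_real (f z)) k"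
proof -
  let ?e = "\<lambda>x. cis (- (of_int k * x))"
  have d: "\<And>x. (h has_real_derivative h' x) (at x)" "\<And>x. (h' has_real_derivative h x - f x) (at x)"
    and per: "periodic_2pi h" "periodic_2pi h'" and f: "continuous_on UNIV f"
    using hp helmholtz_pair_periodic_deriv[OF hp] by (auto simp: helmholtz_pair_def)
  have h: "continuous_on UNIV h"
    using d by (meson DERIV_isCont continuous_at_imp_continuous_on)
  let ?G = "\<lambda>x. (of_real (h' x) + \<i> * of_int k * of_real (h x)) * ?e x"
  have e: "(?e has_vector_derivative - \<i> * of_int k * ?e x) (at x)" for x
  proof -
    have "((\<lambda>z. exp (- \<i> * of_int k * z)) has_field_derivative - \<i> * of_int k * exp (- \<i> * of_int k * of_real x))
        (at (of_real x))"
      by (auto intro!: derivative_eq_intros)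
    from has_vector_derivative_real_field[OF this] show ?thesis
      by (simp add: cis_conv_exp mult.assoc)
  qed
  have "(?G has_vector_derivative
      (of_real (h x - f x) + \<i> * of_int k * of_real (h' x)) * ?e x +
      (of_real (h' x) + \<i> * of_int k * of_real (h x)) * (- \<i> * of_int k * ?e x)) (at x)" for x
    by (auto intro!: derivative_eq_intros e has_vector_derivative_of_real d
        simp: has_real_derivative_iff_has_vector_derivative[symmetric])
  then have G: "(?G has_vector_derivative
      (1 + (of_int k)\<^sup>2) * (of_real (h x) * ?e x) - of_real (f x) * ?e x) (at x)" for x
    by (simp add: algebra_simps power2_eq_square)
  have "((\<lambda>x. (1 + (of_int k)\<^sup>2) * (of_real (h x) * ?e x) - of_real (f x) * ?e x)
      has_integral (?G (2 * pi) - ?G 0)) {0..2 * pi}"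
    using G by (intro fundamental_theorem_of_calculus) (auto intro: has_vector_derivative_at_within)
  moreover have "?G (2 * pi) - ?G 0 = 0"
    using periodic_2pi_of_int[OF per(1), of 0 1] periodic_2pi_of_int[OF per(2), of 0 1]
      periodic_2pi_of_int[OF periodic_2pi_cis[of "- k"], of 0 1] by simp
  ultimately have "integral {0..2 * pi} (\<lambda>x. (1 + (of_int k)\<^sup>2) * (of_real (h x) * ?e x) - of_real (f x) * ?e x) = 0"
    by (simp add: integral_unique)
  then have "(1 + (of_int k)\<^sup>2) * integral {0..2 * pi} (\<lambda>x. of_real (h x) * ?e x) =
      integral {0..2 * pi} (\<lambda>x. of_real (f x) * ?e x)"
    using h f
    by (subst (asm) Henstock_Kurzweil_Integration.integral_diff)
       (auto intro!: fourier_integrand_integrable continuous_intros integrable_on_mult_right)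
  moreover have "1 + (complex_of_int k)\<^sup>2 \<noteq> 0"
  proof -
    have "Re (1 + (complex_of_int k)\<^sup>2) = 1 + (of_int k)\<^sup>2"
      by (simp add: power2_eq_square)
    moreover have "1 + (real_of_int k)\<^sup>2 > 0"
      by (simp add: add_pos_nonneg)
    ultimately show ?thesis by (metis less_irrefl zero_complex.sel(1))
  qed
  ultimately show ?thesis
    unfolding fourier_coeff_def by (simp add: nonzero_eq_divide_eq divide_simps mult.commute)
qed

lemma summable_on_inverse_one_plus_square: "(\<lambda>k::int. 1 / (1 + (of_int k)\<^sup>2) :: real) summable_on UNIV"
proof -
  let ?f = "\<lambda>k::int. 1 / (1 + (of_int k)\<^sup>2) :: real"
  have nat: "(\<lambda>n::nat. 1 / (1 + (of_nat n)\<^sup>2) :: real) summable_on UNIV"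
  proof -
    have "summable (\<lambda>n::nat. 1 / (1 + (of_nat n)\<^sup>2) :: real)"
    proof (rule summable_comparison_test'[where N = 1])
      show "summable (\<lambda>n. 1 / real n ^ 2)"
        using inverse_power_summable[of 2] by (simp add: field_simps)
      show "norm (1 / (1 + (real n)\<^sup>2)) \<le> 1 / real n ^ 2" if "n \<ge> 1" for n
        using that by (simp add: frac_le)
    qed
    then show ?thesis
      by (subst summable_on_UNIV_nonneg_real_iff) auto
  qed
  have "?f summable_on range int"
    by (subst summable_on_reindex) (use nat in \<open>auto simp: o_def\<close>)
  moreover have "?f summable_on range (\<lambda>n. - int n)"
    by (subst summable_on_reindex) (use nat in \<open>auto simp: o_def inj_on_def\<close>)
  ultimately have "?f summable_on (range int \<union> range (\<lambda>n. - int n))"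
    by (rule summable_on_union)
  moreover have "range int \<union> range (\<lambda>n. - int n) = UNIV"
  proof -
    have "k \<in> range int \<union> range (\<lambda>n. - int n)" for k
      by (cases k rule: int_cases) (auto simp: image_iff intro: exI[of _ "Suc _"])
    then show ?thesis by blast
  qed
  ultimately show ?thesis by simp
qed

text \<open>The modes of \<open>h\<close> are bounded by M / (1 + k^2), so the unconditional sum
  exists. Its value may then be computed along symmetric partial sums, for which
  \<open>fourier_inversion\<close> is available.\<close>

lemma inv_helmholtz_eq:
  assumes hp: "helmholtz_pair f h h'"
  shows "inv_helmholtz (\<lambda>z. of_real (f z)) x = of_real (h x)"
proof -
  let ?c = "\<lambda>k. fourier_coeff (\<lambda>z. complex_of_real (h z)) k * cis (of_int k * x)"
  have f: "periodic_2pi f" "continuous_on UNIV f"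
    and h: "periodic_2pi h" "\<And>x. (h has_real_derivative h' x) (at x)"
    using hp by (auto simp: helmholtz_pair_def)
  obtain M where M: "\<And>x. norm (f x) \<le> M"
    using periodic_2pi_bounded[OF f] by blast
  have le: "norm (?c k) \<le> M * (1 / (1 + (of_int k)\<^sup>2))" for k
  proof -
    have "norm (fourier_coeff (\<lambda>z. complex_of_real (f z)) k) \<le> M"
      using M by (intro fourier_coeff_bound continuous_intros f) auto
    moreover have "norm (1 + (complex_of_int k)\<^sup>2) = 1 + (of_int k)\<^sup>2"
    proof -
      have "1 + (complex_of_int k)\<^sup>2 = of_real (1 + (of_int k)\<^sup>2)" by simp
      then show ?thesis by (simp only: norm_of_real) (simp add: add_nonneg_nonneg)
    qed
    ultimately show ?thesis
      unfolding fourier_coeff_helmholtz[OF hp]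
      by (simp add: norm_mult norm_divide divide_right_mono add_nonneg_nonneg)
  qed
  have "(\<lambda>k. norm (?c k)) summable_on UNIV"
    by (rule summable_on_comparison_test[OF summable_on_cmult_right[OF summable_on_inverse_one_plus_square]])
       (use le in auto)
  then have "?c summable_on UNIV"
    by (rule abs_summable_summable)
  then have S: "(?c has_sum (\<Sum>\<^sub>\<infinity>k. ?c k)) UNIV"
    by simp
  have "filterlim (\<lambda>N. {- int N..int N}) (finite_subsets_at_top UNIV) sequentially"
    unfolding filterlim_finite_subsets_at_top
  proof safe
    fix X :: "int set" assume X: "finite X"
    obtain B where B: "\<And>k. k \<in> X \<Longrightarrow> \<bar>k\<bar> \<le> B"
      using X unfolding finite_int_iff_bounded_le by auto
    show "\<forall>\<^sub>F N in sequentially. finite {- int N..int N} \<and> X \<subseteq> {- int N..int N} \<and> {- int N..int N} \<subseteq> UNIV"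
      using eventually_ge_at_top[of "nat B"] by eventually_elim (use B in fastforce)
  qed
  with S have "(\<lambda>N. \<Sum>k\<in>{- int N..int N}. ?c k) \<longlonglongrightarrow> (\<Sum>\<^sub>\<infinity>k. ?c k)"
    unfolding has_sum_def by (rule filterlim_compose)
  then have "(\<Sum>\<^sub>\<infinity>k. ?c k) = of_real (h x)"
    using fourier_inversion[OF h] LIMSEQ_unique by blast
  then show ?thesis
    unfolding inv_helmholtz_def fourier_multiplier_def fourier_coeff_helmholtz[OF hp] .
qed

text \<open>The real part discards nothing for continuous periodic \<open>f\<close>, where
  \<open>inv_helmholtz\<close> is real; see
  \<open>inv_helmholtz_conv_helmholtz_inverse\<close>.\<close>

definition helmholtz_inverse :: "(real \<Rightarrow> real) \<Rightarrow> real \<Rightarrow> real" where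
  "helmholtz_inverse f x = Re (inv_helmholtz (\<lambda>z. of_real (f z)) x)"

lemma helmholtz_inverse_eq:
  "helmholtz_pair f h h' \<Longrightarrow> helmholtz_inverse f = h"
  by (simp add: fun_eq_iff helmholtz_inverse_def inv_helmholtz_eq)

lemma helmholtz_inverse_pair:
  assumes "periodic_2pi f" "continuous_on UNIV f"
  obtains h' where "helmholtz_pair f (helmholtz_inverse f) h'"
  using helmholtz_pair_exists[OF assms] helmholtz_inverse_eq by metis

lemma inv_helmholtz_conv_helmholtz_inverse:
  assumes "periodic_2pi f" "continuous_on UNIV f"
  shows "inv_helmholtz (\<lambda>z. of_real (f z)) x = of_real (helmholtz_inverse f x)"
  using helmholtz_inverse_pair[OF assms] inv_helmholtz_eq by metis

section \<open>Taylor coefficients of periodic analytic functions\<close>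

lemma power_series_deriv:
  fixes g :: "real \<Rightarrow> real"
  assumes sums: "\<And>x. \<bar>x - x0\<bar> < r \<Longrightarrow> (\<lambda>n. c n * (x - x0) ^ n) sums g x"
    and x: "\<bar>x - x0\<bar> < r"
  shows "(g has_real_derivative deriv g x) (at x)"
    and "(\<lambda>n. diffs c n * (x - x0) ^ n) sums deriv g x"
proof -
  have summ: "summable (\<lambda>n. c n * z ^ n)" if "norm z < r" for z
    using sums[of "x0 + z"] that by (auto simp: sums_iff)
  have "((\<lambda>z. \<Sum>n. c n * z ^ n) has_field_derivative (\<Sum>n. diffs c n * (x - x0) ^ n)) (at (x - x0))"
    by (rule termdiffs_strong'[of r]) (use summ x in auto)
  then have "((\<lambda>y. \<Sum>n. c n * (y + (- x0)) ^ n) has_field_derivative (\<Sum>n. diffs c n * (x - x0) ^ n)) (at x)"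
    using DERIV_shift[of "\<lambda>z. \<Sum>n. c n * z ^ n" _ x "- x0"] by simp
  then have der: "(g has_field_derivative (\<Sum>n. diffs c n * (x - x0) ^ n)) (at x)"
  proof (rule has_field_derivative_transform_within_open[where S = "ball x0 r"])
    show "x \<in> ball x0 r" using x by (simp add: dist_norm abs_minus_commute)
    show "(\<Sum>n. c n * (y + - x0) ^ n) = g y" if "y \<in> ball x0 r" for y
      using sums[of y] that by (simp add: dist_norm abs_minus_commute sums_iff)
  qed auto
  then show "(g has_real_derivative deriv g x) (at x)"
    by (simp add: DERIV_imp_deriv)
  have "summable (\<lambda>n. diffs c n * (x - x0) ^ n)"
    by (rule termdiff_converges[of _ r]) (use summ x in auto)
  then show "(\<lambda>n. diffs c n * (x - x0) ^ n) sums deriv g x"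
    using der by (simp add: DERIV_imp_deriv summable_sums)
qed

lemma power_series_higher_deriv:
  fixes f :: "real \<Rightarrow> real"
  assumes "\<And>x. \<bar>x - x0\<bar> < r \<Longrightarrow> (\<lambda>n. c n * (x - x0) ^ n) sums f x"
    and "\<bar>x - x0\<bar> < r"
  shows "(\<lambda>n. (diffs ^^ j) c n * (x - x0) ^ n) sums (deriv ^^ j) f x"
  using assms(2)
proof (induction j arbitrary: x)
  case 0
  then show ?case using assms(1) by simp
next
  case (Suc j)
  then show ?case using power_series_deriv(2)[OF Suc.IH] by simp
qed

lemma funpow_diffs:
  fixes c :: "nat \<Rightarrow> 'a :: real_normed_field"
  shows "(diffs ^^ j) c n = fact j * of_nat ((n + j) choose j) * c (n + j)"
proof (induction j arbitrary: n)
  case (Suc j)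
  have "Suc n * (Suc n + j choose j) = Suc j * (n + Suc j choose Suc j)"
    using Suc_times_binomial_add[of j n] by (simp add: add_ac)
  then have *: "(of_nat (Suc n) * of_nat (Suc n + j choose j) :: 'a) = of_nat (Suc j) * of_nat (n + Suc j choose Suc j)"
    by (metis of_nat_mult)
  have "(diffs ^^ Suc j) c n = of_nat (Suc n) * of_nat (Suc n + j choose j) * (fact j * c (Suc n + j))"
    using Suc.IH[of "Suc n"] by (simp add: diffs_def[of "(diffs ^^ j) c"] mult_ac del: of_nat_Suc)
  also have "\<dots> = fact (Suc j) * of_nat (n + Suc j choose Suc j) * c (n + Suc j)"
    unfolding * by (simp add: mult_ac)
  finally show ?case .
qed simp

text \<open>Models the family f^(j) / j!. With this normalisation products become plain Cauchy
  convolutions, and analyticity becomes a geometric bound in j.\<close>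

definition taylor_tower :: "(nat \<Rightarrow> real \<Rightarrow> real) \<Rightarrow> bool" where
  "taylor_tower F \<longleftrightarrow> (\<forall>j x. (F j has_real_derivative real (Suc j) * F (Suc j) x) (at x))"

lemma taylor_tower_continuous: "taylor_tower F \<Longrightarrow> continuous_on S (F j)"
  unfolding taylor_tower_def by (meson DERIV_isCont continuous_at_imp_continuous_on)

lemma taylor_tower_periodic:
  assumes F: "taylor_tower F" and per: "periodic_2pi (F 0)"
  shows "periodic_2pi (F j)"
proof (induction j)
  case (Suc j)
  have "periodic_2pi (\<lambda>x. real (Suc j) * F (Suc j) x)"
    by (rule periodic_2pi_deriv[OF Suc]) (use F in \<open>simp add: taylor_tower_def\<close>)
  then show ?case
    by (simp add: periodic_2pi_def del: of_nat_Suc)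
qed (rule per)

text \<open>Convergence at distance \<rho> bounds the n-th coefficient by M / \<rho>^n. The
  constants serve all points near \<open>x0\<close> simultaneously, as a compactness argument
  requires.\<close>

lemma real_analytic_at_local_bound:
  assumes "real_analytic_at f x0"
  obtains A R d where "A \<ge> 0" "R \<ge> 0" "d > 0"
    "\<And>x j. \<bar>x - x0\<bar> < d \<Longrightarrow> \<bar>(deriv ^^ j) f x / fact j\<bar> \<le> A * R ^ j"
proof -
  obtain c r where r: "r > 0" and
    sums: "\<And>x. \<bar>x - x0\<bar> < r \<Longrightarrow> (\<lambda>n. c n * (x - x0) ^ n) sums f x"
    using assms unfolding real_analytic_at_def by blast
  define \<rho> where "\<rho> = r / 2"
  have \<rho>: "\<rho> > 0" "\<rho> < r" using r by (auto simp: \<rho>_def)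
  have "summable (\<lambda>n. c n * \<rho> ^ n)"
    using sums[of "x0 + \<rho>"] \<rho> by (auto simp: sums_iff)
  then have "Bseq (\<lambda>n. c n * \<rho> ^ n)"
    using summable_LIMSEQ_zero convergent_imp_Bseq convergent_def by blast
  then obtain M where M: "M > 0" "\<And>n. norm (c n * \<rho> ^ n) \<le> M"
    unfolding Bseq_def by blast
  have c: "\<bar>c n\<bar> \<le> M / \<rho> ^ n" for n
    using M(2)[of n] \<rho> by (simp add: abs_mult pos_le_divide_eq)
  have "\<bar>(deriv ^^ j) f x / fact j\<bar> \<le> (2 * M) * (2 / \<rho>) ^ j" if x: "\<bar>x - x0\<bar> < \<rho> / 4" for x j
  proof -
    have "(\<lambda>n. (diffs ^^ j) c n * (x - x0) ^ n / fact j) sums ((deriv ^^ j) f x / fact j)"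
      by (intro sums_divide power_series_higher_deriv[OF sums]) (use x \<rho> in auto)
    then have S: "(\<lambda>n. of_nat ((n + j) choose j) * c (n + j) * (x - x0) ^ n) sums ((deriv ^^ j) f x / fact j)"
      by (simp add: funpow_diffs mult.assoc)
    have le: "norm (of_nat ((n + j) choose j) * c (n + j) * (x - x0) ^ n) \<le> M * (2 / \<rho>) ^ j * (1 / 2) ^ n" for n
    proof -
      have b: "real ((n + j) choose j) \<le> 2 ^ (n + j)"
        using binomial_le_pow2[of "n + j" j] by (metis of_nat_le_iff of_nat_numeral of_nat_power)
      have "norm (of_nat ((n + j) choose j) * c (n + j) * (x - x0) ^ n) =
          real ((n + j) choose j) * \<bar>c (n + j)\<bar> * \<bar>x - x0\<bar> ^ n"
        by (simp add: abs_mult power_abs)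
      \<comment> \<open>The binomial costs a factor 2 per power of n, so the distance \<rho> / 4
        leaves a geometric series of ratio 1 / 2.\<close>
      also have "\<dots> \<le> 2 ^ (n + j) * (M / \<rho> ^ (n + j)) * (\<rho> / 4) ^ n"
        using b c x M \<rho> by (intro mult_mono power_mono) auto
      also have "\<dots> = M * (2 / \<rho>) ^ j * (1 / 2) ^ n"
      proof -
        have "(4::real) ^ n = 2 ^ n * 2 ^ n" by (simp flip: power_mult_distrib)
        then show ?thesis using \<rho> by (simp add: power_add power_divide field_simps)
      qed
      finally show ?thesis .
    qed
    have geo: "(\<lambda>n. M * (2 / \<rho>) ^ j * (1 / 2) ^ n) sums (M * (2 / \<rho>) ^ j * 2)"
      using sums_mult[OF geometric_sums[of "1 / 2 :: real"]] by simp
    have "norm (\<Sum>n. of_nat ((n + j) choose j) * c (n + j) * (x - x0) ^ n) \<le>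
        (\<Sum>n. M * (2 / \<rho>) ^ j * (1 / 2) ^ n)"
      by (rule norm_suminf_le[OF le sums_summable[OF geo]])
    then show ?thesis
      using S geo by (simp add: sums_iff)
  qed
  with M \<rho> show ?thesis
    by (intro that[of "2 * M" "2 / \<rho>" "\<rho> / 4"]) auto
qed

text \<open>A finite subcover of one period makes the local bounds uniform. The denominator is then
  bought by enlarging the rate fourfold, since (j + 1)^2 \<le> 4^j.\<close>

lemma real_analytic_taylor_tower:
  assumes per: "periodic_2pi f" and an: "\<And>x. real_analytic_at f x"
  obtains F A R where "taylor_tower F" "F 0 = f" "A > 0" "R > 0"
    "\<And>j x. \<bar>F j x\<bar> \<le> A * R ^ j / (real j + 1)\<^sup>2"
proof -
  define F where "F j x = (deriv ^^ j) f x / fact j" for j x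
  have "((deriv ^^ j) f has_real_derivative (deriv ^^ Suc j) f x) (at x)" for j x
  proof -
    obtain c r where r: "r > 0" and
      sums: "\<And>y. \<bar>y - x\<bar> < r \<Longrightarrow> (\<lambda>n. c n * (y - x) ^ n) sums f y"
      using an[of x] unfolding real_analytic_at_def by blast
    have "((deriv ^^ j) f has_real_derivative deriv ((deriv ^^ j) f) x) (at x)"
      by (rule power_series_deriv(1)[OF power_series_higher_deriv[OF sums]]) (use r in auto)
    then show ?thesis by simp
  qed
  then have tower: "taylor_tower F"
    unfolding taylor_tower_def F_def by (auto intro!: derivative_eq_intros simp del: of_nat_Suc)
  have F0: "F 0 = f" by (simp add: F_def fun_eq_iff)
  have "\<forall>x0. \<exists>A R d. A \<ge> 0 \<and> R \<ge> 0 \<and> d > 0 \<and> (\<forall>x j. \<bar>x - x0\<bar> < d \<longrightarrow> \<bar>F j x\<bar> \<le> A * R ^ j)"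
    unfolding F_def by (metis an real_analytic_at_local_bound)
  then obtain A R d where bd: "\<And>x0. A x0 \<ge> (0::real)" "\<And>x0. R x0 \<ge> (0::real)" "\<And>x0. d x0 > (0::real)"
    "\<And>x0 x j. \<bar>x - x0\<bar> < d x0 \<Longrightarrow> \<bar>F j x\<bar> \<le> A x0 * R x0 ^ j"
    by metis
  obtain C where C: "finite C" "{0..2 * pi} \<subseteq> (\<Union>x\<in>C. ball x (d x))"
  proof (rule compactE_image[of "{0..2 * pi}" UNIV "\<lambda>x. ball x (d x)"])
    show "{0..2 * pi} \<subseteq> (\<Union>x\<in>UNIV. ball x (d x))"
      using centre_in_ball bd(3) by blast
  qed auto
  \<comment> \<open>A sum over the finite cover dominates each local constant; the added 1 makes it
    positive.\<close>
  define A' where "A' = 1 + (\<Sum>x\<in>C. A x)"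
  define R' where "R' = 1 + (\<Sum>x\<in>C. R x)"
  have pos: "A' > 0" "R' > 0"
    unfolding A'_def R'_def using bd by (auto intro!: add_pos_nonneg sum_nonneg)
  have "\<bar>F j x\<bar> \<le> A' * R' ^ j" for j x
  proof -
    obtain y where y: "0 \<le> y" "y \<le> 2 * pi" "F j y = F j x"
      using periodic_2pi_reduce[OF taylor_tower_periodic[OF tower]] F0 per by metis
    then obtain z where z: "z \<in> C" "\<bar>y - z\<bar> < d z"
      using C(2) by (force simp: dist_norm abs_minus_commute)
    have "A z \<le> A'" "R z \<le> R'"
      unfolding A'_def R'_def using member_le_sum[of z C A] member_le_sum[of z C R] z(1) C(1) bd
      by force+
    then have "A z * R z ^ j \<le> A' * R' ^ j"
      using bd pos by (intro mult_mono power_mono) auto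
    then show ?thesis using bd(4)[OF z(2), of j] y(3) by simp
  qed
  moreover have "A' * R' ^ j \<le> A' * (4 * R') ^ j / (real j + 1)\<^sup>2" for j
  proof -
    have "real j + 1 \<le> 2 ^ j"
      using of_nat_le_iff[of "Suc j" "2 ^ j", where ?'a = real] by (simp add: Suc_leI)
    then have "(real j + 1)\<^sup>2 \<le> (2 ^ j)\<^sup>2"
      by (intro power_mono) auto
    also have "\<dots> = 4 ^ j"
      by (simp add: power2_eq_square flip: power_mult_distrib)
    finally have "A' * R' ^ j * (real j + 1)\<^sup>2 \<le> A' * R' ^ j * 4 ^ j"
      using pos by (intro mult_left_mono) auto
    then show ?thesis
      by (simp add: pos_le_divide_eq power_mult_distrib mult_ac)
  qed
  ultimately have "\<bar>F j x\<bar> \<le> A' * (4 * R') ^ j / (real j + 1)\<^sup>2" for j x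
    using order_trans by blast
  then show ?thesis
    using that[OF tower F0 pos(1), of "4 * R'"] pos(2) by simp
qed

section \<open>Majorants for the recursion\<close>

text \<open>Leibniz rule: after reindexing, the term F l * G (Suc j - l) receives the weights l and
  Suc j - l, which add up to Suc j.\<close>

lemma taylor_tower_mult:
  assumes F: "taylor_tower F" and G: "taylor_tower G"
  shows "taylor_tower (\<lambda>j x. \<Sum>l\<le>j. F l x * G (j - l) x)"
  unfolding taylor_tower_def
proof (intro allI)
  fix j x
  have d: "(F l has_real_derivative real (Suc l) * F (Suc l) x) (at x)"
    "(G l has_real_derivative real (Suc l) * G (Suc l) x) (at x)" for l
    using F G by (auto simp: taylor_tower_def)
  have "((\<lambda>x. \<Sum>l\<le>j. F l x * G (j - l) x) has_real_derivative
      (\<Sum>l\<le>j. real (Suc l) * F (Suc l) x * G (j - l) x + real (Suc (j - l)) * G (Suc (j - l)) x * F l x)) (at x)"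
    by (intro DERIV_sum DERIV_mult d)
  also have "(\<Sum>l\<le>j. real (Suc l) * F (Suc l) x * G (j - l) x + real (Suc (j - l)) * G (Suc (j - l)) x * F l x) =
      (\<Sum>l\<le>j. real (Suc l) * F (Suc l) x * G (Suc j - Suc l) x) +
      (\<Sum>l\<le>j. real (Suc j - l) * F l x * G (Suc j - l) x)"
    by (auto simp: sum.distrib[symmetric] Suc_diff_le intro!: sum.cong)
  \<comment> \<open>The terms added to reach a common range, l = 0 here and l = Suc j in the next
    step, have weight 0.\<close>
  also have "(\<Sum>l\<le>j. real (Suc l) * F (Suc l) x * G (Suc j - Suc l) x) =
      (\<Sum>l\<le>Suc j. real l * F l x * G (Suc j - l) x)"
    by (subst sum.atMost_Suc_shift) simp
  also have "(\<Sum>l\<le>j. real (Suc j - l) * F l x * G (Suc j - l) x) =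
      (\<Sum>l\<le>Suc j. real (Suc j - l) * F l x * G (Suc j - l) x)"
    by simp
  also have "(\<Sum>l\<le>Suc j. real l * F l x * G (Suc j - l) x) + \<dots> =
      (\<Sum>l\<le>Suc j. real (Suc j) * (F l x * G (Suc j - l) x))"
    unfolding sum.distrib[symmetric]
    by (intro sum.cong refl) (auto simp: of_nat_diff algebra_simps)
  also have "\<dots> = real (Suc j) * (\<Sum>l\<le>Suc j. F l x * G (Suc j - l) x)"
    by (rule sum_distrib_left[symmetric])
  finally show "((\<lambda>x. \<Sum>l\<le>j. F l x * G (j - l) x) has_real_derivative
      real (Suc j) * (\<Sum>l\<le>Suc j. F l x * G (Suc j - l) x)) (at x)" .
qed

lemma taylor_tower_sum:
  assumes "\<And>i. i \<in> I \<Longrightarrow> taylor_tower (F i)"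
  shows "taylor_tower (\<lambda>j x. \<Sum>i\<in>I. F i j x)"
  unfolding taylor_tower_def sum_distrib_left
  using assms by (auto intro!: DERIV_sum simp: taylor_tower_def)

lemma taylor_tower_lincomb:
  assumes "taylor_tower F" "taylor_tower G"
  shows "taylor_tower (\<lambda>j x. a * F j x + b * G j x)"
  unfolding taylor_tower_def
proof (intro allI)
  fix j x
  have "((\<lambda>x. a * F j x + b * G j x) has_real_derivative
      a * (real (Suc j) * F (Suc j) x) + b * (real (Suc j) * G (Suc j) x)) (at x)"
    using assms unfolding taylor_tower_def by (intro DERIV_add DERIV_cmult) auto
  then show "((\<lambda>x. a * F j x + b * G j x) has_real_derivative
      real (Suc j) * (a * F (Suc j) x + b * G (Suc j) x)) (at x)"
    by (simp add: algebra_simps)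
qed

lemma taylor_tower_shift:
  assumes "taylor_tower F"
  shows "taylor_tower (\<lambda>j x. real (Suc j) * F (Suc j) x)"
  using assms unfolding taylor_tower_def by (blast intro: DERIV_cmult)

text \<open>The derivative of \<open>helmholtz_inverse (F j)\<close> and the multiple of the next
  entry both solve the Helmholtz equation with datum the derivative of \<open>F j\<close>;
  uniqueness identifies them.\<close>

lemma taylor_tower_helmholtz_inverse:
  assumes F: "taylor_tower F" and per: "\<And>j. periodic_2pi (F j)"
  shows "taylor_tower (\<lambda>j. helmholtz_inverse (F j))"
  unfolding taylor_tower_def
proof (intro allI)
  fix j x
  have c: "continuous_on UNIV (F j)" for j
    using F by (rule taylor_tower_continuous)
  have "\<exists>h. helmholtz_pair (F j) (helmholtz_inverse (F j)) h" for j
    using helmholtz_inverse_pair[OF per c] by blast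
  then obtain h k where h: "helmholtz_pair (F j) (helmholtz_inverse (F j)) h"
    and k: "helmholtz_pair (F (Suc j)) (helmholtz_inverse (F (Suc j))) k"
    by metis
  have "helmholtz_pair (\<lambda>x. real (Suc j) * F (Suc j) x) h (\<lambda>x. helmholtz_inverse (F j) x - F j x)"
    by (rule helmholtz_pair_deriv[OF h]) (use F c in \<open>auto simp: taylor_tower_def intro!: continuous_intros\<close>)
  moreover have "helmholtz_pair (\<lambda>x. real (Suc j) * F (Suc j) x) (\<lambda>x. real (Suc j) * helmholtz_inverse (F (Suc j)) x) (\<lambda>x. real (Suc j) * k x)"
    using helmholtz_pair_lincomb[OF k k, of "real (Suc j)" 0] by simp
  ultimately have "h = (\<lambda>x. real (Suc j) * helmholtz_inverse (F (Suc j)) x)"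
    by (rule helmholtz_pair_unique)
  then show "(helmholtz_inverse (F j) has_real_derivative real (Suc j) * helmholtz_inverse (F (Suc j)) x) (at x)"
    using h unfolding helmholtz_pair_def by simp
qed

lemma helmholtz_inverse_bound:
  assumes "periodic_2pi f" "continuous_on UNIV f" "\<And>x. \<bar>f x\<bar> \<le> M"
  shows "\<bar>helmholtz_inverse f x\<bar> \<le> M"
  using helmholtz_inverse_pair[OF assms(1,2)] helmholtz_pair_bound assms(3) by metis

lemma periodic_2pi_helmholtz_inverse:
  assumes "periodic_2pi f" "continuous_on UNIV f"
  shows "periodic_2pi (helmholtz_inverse f)"
  using helmholtz_inverse_pair[OF assms] by (metis helmholtz_pair_def)

text \<open>The coefficient of \<open>t\<^sup>n X\<^sup>j\<close> in the expansion of \<open>u (x + X, t)\<close>; the nonlinearity is used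
  in the form \<open>\<partial>\<^sub>x (3/4 u\<^sup>2)\<close>.\<close>

fun FW_coeff :: "(nat \<Rightarrow> real \<Rightarrow> real) \<Rightarrow> nat \<Rightarrow> nat \<Rightarrow> real \<Rightarrow> real" where
  "FW_coeff F 0 j x = F j x"
| "FW_coeff F (Suc n) j x = real (Suc j) / real (Suc n) *
     (helmholtz_inverse (FW_coeff F n (Suc j)) x
      - 3 / 4 * (\<Sum>i\<le>n. \<Sum>l\<le>Suc j. FW_coeff F i l x * FW_coeff F (n - i) (Suc j - l) x))"

lemma taylor_tower_FW_coeff:
  assumes F: "taylor_tower F" and per: "periodic_2pi (F 0)"
  shows "taylor_tower (FW_coeff F n) \<and> (\<forall>j. periodic_2pi (FW_coeff F n j))"
proof (induction n rule: less_induct)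
  case (less n)
  show ?case
  proof (cases n)
    case 0
    then have "FW_coeff F n = F" by (auto simp: fun_eq_iff)
    then show ?thesis using F per taylor_tower_periodic[OF F] by simp
  next
    case (Suc m)
    have tow: "taylor_tower (FW_coeff F i)" "periodic_2pi (FW_coeff F i j)" if "i \<le> m" for i j
      using less[of i] that Suc by auto
    \<comment> \<open>\<open>G\<close> is the tower of the quantity whose x-derivative is level
      \<open>n\<close>; \<open>taylor_tower_shift\<close> performs that differentiation.\<close>
    define G where "G j x = 1 / real n * helmholtz_inverse (FW_coeff F m j) x +
       (- (3 / 4) / real n) * (\<Sum>i\<le>m. \<Sum>l\<le>j. FW_coeff F i l x * FW_coeff F (m - i) (j - l) x)" for j x
    have "taylor_tower G"
      unfolding G_def
      by (intro taylor_tower_lincomb taylor_tower_helmholtz_inverse taylor_tower_sum taylor_tower_mult tow) auto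
    then have "taylor_tower (\<lambda>j x. real (Suc j) * G (Suc j) x)"
      by (rule taylor_tower_shift)
    moreover have "p * (1 / q * h + (- (3 / 4) / q) * s) = p / q * (h - 3 / 4 * s)" for p q h s :: real
      by (cases "q = 0") (auto simp: field_simps)
    then have "(\<lambda>j x. real (Suc j) * G (Suc j) x) = FW_coeff F n"
      unfolding Suc FW_coeff.simps fun_eq_iff G_def by blast
    ultimately have 1: "taylor_tower (FW_coeff F n)" by simp
    have h: "periodic_2pi (helmholtz_inverse (FW_coeff F m j))" for j
      by (intro periodic_2pi_helmholtz_inverse tow taylor_tower_continuous) auto
    have "FW_coeff F n 0 (x + 2 * pi) = FW_coeff F n 0 x" for x
    proof -
      have "(\<Sum>i\<le>m. \<Sum>l\<le>Suc 0. FW_coeff F i l (x + 2 * pi) * FW_coeff F (m - i) (Suc 0 - l) (x + 2 * pi)) =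
          (\<Sum>i\<le>m. \<Sum>l\<le>Suc 0. FW_coeff F i l x * FW_coeff F (m - i) (Suc 0 - l) x)"
        using tow(2) unfolding periodic_2pi_def by (intro sum.cong refl arg_cong2[where f = "(*)"]) auto
      then show ?thesis
        unfolding Suc FW_coeff.simps using h[of "Suc 0"] unfolding periodic_2pi_def by simp
    qed
    then show ?thesis
      using 1 taylor_tower_periodic[OF 1] by (simp add: periodic_2pi_def)
  qed
qed

section \<open>Convolution identities and the majorant bound\<close>

text \<open>Terms are grouped by total degree s = i + l and Vandermonde's identity sums over
  \<open>l\<close>. It is the coefficient form of (X + T)^s (X + T)^(N - s) = (X + T)^N, N = n + m,
  weighted by \<phi> s.\<close>

lemma sum_binomial_convolution:
  fixes \<phi> :: "nat \<Rightarrow> real"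
  shows "(\<Sum>i\<le>n. \<Sum>l\<le>m. real (i + l choose l) * real (n - i + (m - l) choose (m - l)) * \<phi> (i + l)) =
    real (n + m choose m) * (\<Sum>s\<le>n + m. \<phi> s)"
proof -
  have inner: "(\<Sum>i\<le>n. real (i + l choose l) * real (n - i + (m - l) choose (m - l)) * \<phi> (i + l)) =
      (\<Sum>s\<le>n + m. real (s choose l) * real (n + m - s choose (m - l)) * \<phi> s)" if l: "l \<le> m" for l
  proof -
    let ?g = "\<lambda>s. real (s choose l) * real (n + m - s choose (m - l)) * \<phi> s"
    have "(\<Sum>i\<le>n. real (i + l choose l) * real (n - i + (m - l) choose (m - l)) * \<phi> (i + l)) = (\<Sum>i\<le>n. ?g (i + l))"
    proof (intro sum.cong refl)
      fix i assume "i \<in> {..n}"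
      then have "n - i + (m - l) = n + m - (i + l)" using l by auto
      then show "real (i + l choose l) * real (n - i + (m - l) choose (m - l)) * \<phi> (i + l) = ?g (i + l)"
        by simp
    qed
    also have "\<dots> = (\<Sum>s=0+l..n+l. ?g s)"
      unfolding sum.shift_bounds_cl_nat_ivl by (simp add: atMost_atLeast0)
    \<comment> \<open>The added terms vanish: \<open>s choose l\<close> when s < l, and
      \<open>n + m - s choose (m - l)\<close> when s > n + l.\<close>
    also have "\<dots> = (\<Sum>s\<le>n + m. ?g s)"
      using l by (intro sum.mono_neutral_left) (auto simp: binomial_eq_0)
    finally show ?thesis .
  qed
  have "(\<Sum>i\<le>n. \<Sum>l\<le>m. real (i + l choose l) * real (n - i + (m - l) choose (m - l)) * \<phi> (i + l)) =
      (\<Sum>l\<le>m. \<Sum>s\<le>n + m. real (s choose l) * real (n + m - s choose (m - l)) * \<phi> s)"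
    by (subst sum.swap, rule sum.cong[OF refl], rule inner, simp)
  also have "\<dots> = (\<Sum>s\<le>n + m. real (\<Sum>l\<le>m. (s choose l) * (n + m - s choose (m - l))) * \<phi> s)"
    by (subst sum.swap) (simp add: sum_distrib_right)
  also have "\<dots> = (\<Sum>s\<le>n + m. real (n + m choose m) * \<phi> s)"
    by (intro sum.cong refl) (simp add: vandermonde)
  finally show ?thesis by (simp add: sum_distrib_left)
qed

text \<open>The coefficients of the majorant \<Phi>. They are summable and, up to a constant, stable
  under convolution.\<close>

definition weight :: "nat \<Rightarrow> real" where
  "weight s = 1 / (real s + 1)\<^sup>2"

lemma weight_pos: "weight s > 0"
  by (simp add: weight_def)

text \<open>Telescoping comparison with 1 / s - 1 / (s + 1); the induction needs the sharper bound 2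
  - 1 / (N + 1).\<close>

lemma sum_weight: "(\<Sum>s\<le>N. weight s) \<le> 2"
proof -
  have "(\<Sum>s\<le>N. weight s) \<le> 2 - 1 / (real N + 1)"
  proof (induction N)
    case (Suc N)
    have "weight (Suc N) \<le> 1 / (real N + 1) - 1 / (real N + 2)"
      by (simp add: weight_def divide_simps power2_eq_square) (simp add: algebra_simps)
    then show ?case using Suc by (simp add: add_ac)
  qed (simp add: weight_def)
  moreover have "1 / (real N + 1) \<ge> 0" by simp
  ultimately show ?thesis by linarith
qed

text \<open>With a = s + 1 and b = N - s + 1 one has (N + 1)^2 \<le> (a + b)^2 \<le> 2 (a^2 + b^2).
  Division by a^2 b^2 separates the two factors, and both resulting sums are at most 2, whence 8 = 2
  * (2 + 2).\<close>

lemma weight_convolution: "(\<Sum>s\<le>N. weight s * weight (N - s)) \<le> 8 * weight N"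
proof -
  have le: "weight s * weight (N - s) \<le> 2 * weight N * (weight s + weight (N - s))" if s: "s \<le> N" for s
  proof -
    let ?a = "real s + 1" and ?b = "real (N - s) + 1"
    have ab: "?a > 0" "?b > 0" by (auto intro: add_nonneg_pos)
    have N: "real N + 1 \<le> ?a + ?b" using s by simp
    have "(real N + 1)\<^sup>2 \<le> (?a + ?b)\<^sup>2"
      using N by (intro power_mono) auto
    also have "\<dots> \<le> 2 * (?a\<^sup>2 + ?b\<^sup>2)"
      using zero_le_power2[of "?a - ?b"] by (simp add: power2_eq_square algebra_simps)
    finally have "(real N + 1)\<^sup>2 \<le> 2 * (?a\<^sup>2 + ?b\<^sup>2)" .
    then have "1 / (?a\<^sup>2 * ?b\<^sup>2) * (real N + 1)\<^sup>2 \<le> 1 / (?a\<^sup>2 * ?b\<^sup>2) * (2 * (?a\<^sup>2 + ?b\<^sup>2))"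
      by (intro mult_left_mono) auto
    also have "\<dots> = 2 * (1 / ?a\<^sup>2 + 1 / ?b\<^sup>2)"
      using ab by (simp add: divide_simps)
    finally have "1 / (?a\<^sup>2 * ?b\<^sup>2) \<le> 2 * (1 / ?a\<^sup>2 + 1 / ?b\<^sup>2) / (real N + 1)\<^sup>2"
      by (simp add: pos_le_divide_eq)
    then show ?thesis
      by (simp add: weight_def)
  qed
  have "(\<Sum>s\<le>N. weight (N - s)) = (\<Sum>s\<le>N. weight s)"
    by (rule sum.reindex_bij_witness[of _ "\<lambda>s. N - s" "\<lambda>s. N - s"]) auto
  moreover have "(\<Sum>s\<le>N. weight s * weight (N - s)) \<le> (\<Sum>s\<le>N. 2 * weight N * (weight s + weight (N - s)))"
    by (intro sum_mono le) auto
  ultimately have "(\<Sum>s\<le>N. weight s * weight (N - s)) \<le> 2 * weight N * (2 * (\<Sum>s\<le>N. weight s))"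
    by (simp add: sum_distrib_left[symmetric] sum.distrib)
  also have "\<dots> \<le> 2 * weight N * (2 * 2)"
    using sum_weight[of N] weight_pos[of N] by (intro mult_left_mono) auto
  finally show ?thesis by simp
qed

text \<open>The bound is the coefficient of X^j T^n in A \<Phi>(R X + B T) with B = R + 6 A R. The
  induction is strong because the convolution involves all earlier levels.\<close>

lemma FW_coeff_bound:
  assumes F: "taylor_tower F" and per: "periodic_2pi (F 0)" and A: "A > 0" and R: "R > 0"
    and bound: "\<And>j x. \<bar>F j x\<bar> \<le> A * R ^ j * weight j"
  shows "\<bar>FW_coeff F n j x\<bar> \<le> A * R ^ j * (R + 6 * A * R) ^ n * (n + j choose j) * weight (n + j)"
proof (induction n arbitrary: j x rule: less_induct)
  case (less n)
  define B where "B = R + 6 * A * R"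
  have B: "B > 0" using A R by (simp add: B_def add_pos_pos)
  show ?case
  proof (cases n)
    case 0
    then show ?thesis using bound by simp
  next
    case (Suc m)
    let ?c = "FW_coeff F" and ?N = "m + Suc j"
    let ?D = "A * R ^ Suc j * B ^ m * real (?N choose Suc j) * weight ?N"
    have IH: "\<bar>?c i l x\<bar> \<le> A * R ^ l * B ^ i * real (i + l choose l) * weight (i + l)" if "i \<le> m" for i l x
      using less[of i l x] that Suc by (simp add: B_def)
    have tow: "taylor_tower (?c m)" "periodic_2pi (?c m l)" for l
      using taylor_tower_FW_coeff[OF F per, of m] by auto
    have lin: "\<bar>helmholtz_inverse (?c m (Suc j)) x\<bar> \<le> ?D"
      by (rule helmholtz_inverse_bound[OF tow(2) taylor_tower_continuous[OF tow(1)]]) (rule IH, simp)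
    have "\<bar>\<Sum>i\<le>m. \<Sum>l\<le>Suc j. ?c i l x * ?c (m - i) (Suc j - l) x\<bar> \<le>
        (\<Sum>i\<le>m. \<Sum>l\<le>Suc j. A\<^sup>2 * R ^ Suc j * B ^ m * (real (i + l choose l) *
          real (m - i + (Suc j - l) choose (Suc j - l)) * (weight (i + l) * weight (?N - (i + l)))))"
    proof (intro order_trans[OF sum_abs] sum_mono)
      fix i l assume i: "i \<in> {..m}" and l: "l \<in> {..Suc j}"
      have N: "m - i + (Suc j - l) = ?N - (i + l)"
        using i l by auto
      have pw: "R ^ l * R ^ (Suc j - l) = R ^ Suc j" "B ^ i * B ^ (m - i) = B ^ m"
        using i l by (simp_all flip: power_add)
      have "\<bar>?c i l x * ?c (m - i) (Suc j - l) x\<bar> \<le>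
        (A * R ^ l * B ^ i * real (i + l choose l) * weight (i + l)) *
        (A * R ^ (Suc j - l) * B ^ (m - i) * real (m - i + (Suc j - l) choose (Suc j - l)) * weight (m - i + (Suc j - l)))"
        unfolding abs_mult using i l A R B weight_pos
        by (intro mult_mono IH mult_nonneg_nonneg) (auto intro: less_imp_le)
      also have "\<dots> = A * A * (R ^ l * R ^ (Suc j - l)) * (B ^ i * B ^ (m - i)) * (real (i + l choose l) *
          real (m - i + (Suc j - l) choose (Suc j - l)) * (weight (i + l) * weight (m - i + (Suc j - l))))"
        by (simp only: mult_ac)
      finally show "\<bar>?c i l x * ?c (m - i) (Suc j - l) x\<bar> \<le> A\<^sup>2 * R ^ Suc j * B ^ m * (real (i + l choose l) *
          real (m - i + (Suc j - l) choose (Suc j - l)) * (weight (i + l) * weight (?N - (i + l))))"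
        unfolding pw N power2_eq_square .
    qed
    also have "\<dots> = A\<^sup>2 * R ^ Suc j * B ^ m * (real (?N choose Suc j) * (\<Sum>s\<le>?N. weight s * weight (?N - s)))"
      unfolding sum_distrib_left[symmetric]
      by (subst sum_binomial_convolution[where \<phi> = "\<lambda>s. weight s * weight (?N - s)"]) (rule refl)
    also have "\<dots> \<le> A\<^sup>2 * R ^ Suc j * B ^ m * (real (?N choose Suc j) * (8 * weight ?N))"
      using A R B by (intro mult_left_mono weight_convolution) auto
    also have "\<dots> = 8 * A * ?D"
      by (simp add: power2_eq_square)
    finally have nonlin: "\<bar>\<Sum>i\<le>m. \<Sum>l\<le>Suc j. ?c i l x * ?c (m - i) (Suc j - l) x\<bar> \<le> 8 * A * ?D" .
    have "\<bar>?c n j x\<bar> \<le> real (Suc j) / real (Suc m) * (?D + 3 / 4 * (8 * A * ?D))"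
    proof -
      have "\<bar>a - 3 / 4 * b\<bar> \<le> p + 3 / 4 * q" if "\<bar>a\<bar> \<le> p" "\<bar>b\<bar> \<le> q" for a b p q :: real
        using that by (simp add: abs_le_iff)
      from this[OF lin nonlin] show ?thesis
        unfolding Suc FW_coeff.simps abs_mult by (intro mult_mono) auto
    qed
    \<comment> \<open>Origin of B: the linear term contributes 1 and the nonlinear one (3/4) * 8 * A
      = 6 A; together with the surplus R in \<open>R ^ Suc j\<close> this is R (1 + 6 A) =
      B.\<close>
    also have "\<dots> = (real (Suc j) * real (?N choose Suc j)) / real (Suc m) * (A * R ^ j * B ^ Suc m * weight ?N)"
      by (simp add: B_def algebra_simps add_divide_distrib)
    \<comment> \<open>This absorption step produces the factor that cancels the denominator
      \<open>Suc m\<close>.\<close>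
    also have "real (Suc j) * real (?N choose Suc j) = real (Suc m) * real (?N choose j)"
    proof -
      have "Suc j * (?N choose Suc j) = Suc m * (?N choose j)"
        using Suc_times_binomial_add[of j m] by (simp add: add_ac)
      then show ?thesis by (metis of_nat_mult)
    qed
    finally show ?thesis
      by (simp add: Suc B_def mult_ac)
  qed
qed

section \<open>Analytic functions of two variables\<close>

lemma summable_on_geometric_product:
  fixes p q :: real
  assumes "0 \<le> p" "p < 1" "0 \<le> q" "q < 1"
  shows "(\<lambda>(j, n). p ^ j * q ^ n) summable_on (UNIV :: (nat \<times> nat) set)"
proof -
  have geo: "((\<lambda>n. c ^ n) has_sum 1 / (1 - c)) UNIV" if "0 \<le> c" "c < 1" for c :: real
    using that geometric_sums[of c] by (intro sums_nonneg_imp_has_sum) auto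
  have q: "((\<lambda>n. p ^ j * q ^ n) has_sum p ^ j * (1 / (1 - q))) UNIV" for j
    by (intro has_sum_cmult_right geo assms)
  have p: "((\<lambda>j. p ^ j * (1 / (1 - q))) has_sum 1 / (1 - p) * (1 / (1 - q))) UNIV"
    by (intro has_sum_cmult_left geo assms)
  have "(\<lambda>z. norm (case z of (j, n) \<Rightarrow> p ^ j * q ^ n)) summable_on ((UNIV :: nat set) \<times> (UNIV :: nat set))"
    unfolding Infinite_Sum.abs_summable_on_Sigma_iff
    using q p assms by (auto simp: summable_on_def infsumI[OF q])
  then show ?thesis
    using assms by (simp add: case_prod_unfold)
qed

lemma summable_on_power_product:
  fixes a :: "nat \<Rightarrow> nat \<Rightarrow> real"
  assumes a: "\<And>j n. \<bar>a j n\<bar> \<le> M * \<rho> ^ j * \<sigma> ^ n" and "\<rho> > 0" "\<sigma> > 0"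
    and X: "\<bar>X\<bar> < 1 / \<rho>" and T: "\<bar>T\<bar> < 1 / \<sigma>"
  shows "(\<lambda>(j, n). a j n * X ^ j * T ^ n) summable_on UNIV"
proof -
  have "(\<lambda>(j, n). (\<rho> * \<bar>X\<bar>) ^ j * (\<sigma> * \<bar>T\<bar>) ^ n) summable_on (UNIV :: (nat \<times> nat) set)"
    using assms by (intro summable_on_geometric_product) (auto simp: field_simps)
  then have S: "(\<lambda>z. M * (case z of (j, n) \<Rightarrow> (\<rho> * \<bar>X\<bar>) ^ j * (\<sigma> * \<bar>T\<bar>) ^ n)) summable_on (UNIV :: (nat \<times> nat) set)"
    by (rule summable_on_cmult_right)
  have "(\<lambda>z. norm (case z of (j, n) \<Rightarrow> a j n * X ^ j * T ^ n)) summable_on UNIV"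
  proof (rule Infinite_Sum.abs_summable_on_comparison_test'[OF S], clarify)
    fix j n
    have "norm (a j n * X ^ j * T ^ n) = \<bar>a j n\<bar> * (\<bar>X\<bar> ^ j * \<bar>T\<bar> ^ n)"
      by (simp add: abs_mult power_abs)
    also have "\<dots> \<le> (M * \<rho> ^ j * \<sigma> ^ n) * (\<bar>X\<bar> ^ j * \<bar>T\<bar> ^ n)"
      by (intro mult_right_mono a) auto
    finally show "norm (a j n * X ^ j * T ^ n) \<le> M * ((\<rho> * \<bar>X\<bar>) ^ j * (\<sigma> * \<bar>T\<bar>) ^ n)"
      by (simp add: power_mult_distrib mult_ac)
  qed
  then show ?thesis
    by (rule abs_summable_summable)
qed

text \<open>Every term of an absolutely summable family is at most the total \<open>M\<close> of
  absolute values. At distance 1 / s = r / 2 from the centre this is a Cauchy estimate.\<close>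

lemma real_analytic2_atE:
  assumes "real_analytic2_at u x0 t0"
  obtains a M s where "s > 0" "\<And>m n. \<bar>a m n\<bar> \<le> M * s ^ m * s ^ n"
    "\<And>x t. \<lbrakk>\<bar>x - x0\<bar> < 1 / s; \<bar>t - t0\<bar> < 1 / s\<rbrakk> \<Longrightarrow>
       ((\<lambda>(m, n). a m n * (x - x0) ^ m * (t - t0) ^ n) has_sum u x t) UNIV"
proof -
  obtain a r where r: "r > 0" and sum: "\<And>x t. \<lbrakk>\<bar>x - x0\<bar> < r; \<bar>t - t0\<bar> < r\<rbrakk> \<Longrightarrow>
       ((\<lambda>(m, n). a m n * (x - x0) ^ m * (t - t0) ^ n) has_sum u x t) UNIV"
    using assms unfolding real_analytic2_at_def by blast
  define s where "s = 2 / r"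
  have s: "s > 0" "1 / s < r" using r by (auto simp: s_def)
  let ?f = "\<lambda>(m, n). a m n * (1 / s) ^ m * (1 / s) ^ n"
  have "?f summable_on UNIV"
    using sum[of "x0 + 1 / s" "t0 + 1 / s"] s by (auto simp: summable_on_def)
  then have abs: "(\<lambda>z. norm (?f z)) summable_on UNIV"
    by (rule summable_on_iff_abs_summable_on_real[THEN iffD1])
  define M where "M = infsum (\<lambda>z. norm (?f z)) UNIV"
  have "\<bar>a m n\<bar> \<le> M * s ^ m * s ^ n" for m n
  proof -
    have "(\<Sum>z\<in>{(m, n)}. norm (?f z)) \<le> M"
      unfolding M_def by (intro finite_sum_le_infsum abs) auto
    then have "\<bar>a m n\<bar> * (1 / s) ^ m * (1 / s) ^ n \<le> M"
      using s by (simp add: abs_mult)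
    then show ?thesis
      using s by (simp add: power_divide field_simps)
  qed
  then show ?thesis
    using that[of s a M] s sum by (meson less_trans)
qed

lemma real_analytic2_atI:
  fixes a :: "nat \<Rightarrow> nat \<Rightarrow> real"
  assumes bound: "\<And>j n. \<bar>a j n\<bar> \<le> M * \<rho> ^ j * \<sigma> ^ n" and "\<rho> > 0" "\<sigma> > 0"
    and sum: "\<And>x t. \<lbrakk>\<bar>x - x0\<bar> < 1 / \<rho>; \<bar>t\<bar> < 1 / \<sigma>\<rbrakk> \<Longrightarrow>
       ((\<lambda>(j, n). a j n * (x - x0) ^ j * t ^ n) has_sum u x t) UNIV"
    and t0: "\<bar>t0\<bar> < 1 / \<sigma>"
  shows "real_analytic2_at u x0 t0"
proof -
  \<comment> \<open>Ensures |t - t0| + |t0| < 1 / \<sigma>, so the triple series over j, n, k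
    converges absolutely.\<close>
  define r where "r = min (1 / \<rho>) (1 / \<sigma> - \<bar>t0\<bar>)"
  have r: "r > 0" using assms by (auto simp: r_def)
  define b where "b j k = (\<Sum>\<^sub>\<infinity>n. a j n * real (n choose k) * t0 ^ (n - k))" for j k
  have "((\<lambda>(j, k). b j k * (x - x0) ^ j * (t - t0) ^ k) has_sum u x t) UNIV"
    if x: "\<bar>x - x0\<bar> < r" and t: "\<bar>t - t0\<bar> < r" for x t
  proof -
    let ?X = "x - x0" and ?T = "t - t0"
    define f where "f j n k = a j n * ?X ^ j * (real (n choose k) * ?T ^ k * t0 ^ (n - k))" for j n k
    have binom: "((\<lambda>k. real (n choose k) * c ^ k * d ^ (n - k)) has_sum (c + d) ^ n) UNIV" for n and c d :: real
      unfolding binomial_ring by (rule has_sum_finite_neutralI[where B = "{..n}"]) (auto simp: binomial_eq_0)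
    have inner: "((\<lambda>k. f j n k) has_sum a j n * ?X ^ j * t ^ n) UNIV" for j n
      unfolding f_def using has_sum_cmult_right[OF binom[of n ?T t0]] by simp
    have inner_abs: "((\<lambda>k. norm (f j n k)) has_sum \<bar>a j n\<bar> * \<bar>?X\<bar> ^ j * (\<bar>?T\<bar> + \<bar>t0\<bar>) ^ n) UNIV" for j n
      unfolding f_def using has_sum_cmult_right[OF binom[of n "\<bar>?T\<bar>" "\<bar>t0\<bar>"], of "\<bar>a j n\<bar> * \<bar>?X\<bar> ^ j"]
      by (simp add: abs_mult power_abs mult_ac)
    have "(\<lambda>(j, n). \<bar>a j n\<bar> * \<bar>?X\<bar> ^ j * (\<bar>?T\<bar> + \<bar>t0\<bar>) ^ n) summable_on UNIV"
      by (rule summable_on_power_product[where M = M and \<rho> = \<rho> and \<sigma> = \<sigma>])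
         (use assms x t in \<open>auto simp: r_def\<close>)
    then have "(\<lambda>z. norm (infsum (\<lambda>k. norm (f (fst z) (snd z) k)) UNIV)) summable_on UNIV"
      unfolding infsumI[OF inner_abs] by (simp add: case_prod_unfold abs_mult power_abs)
    moreover have "(\<lambda>k. norm (f j n k)) summable_on UNIV" for j n
      using inner_abs summable_on_def by blast
    ultimately have "(\<lambda>z. norm (case z of (z, k) \<Rightarrow> f (fst z) (snd z) k)) summable_on (UNIV \<times> UNIV)"
      unfolding Infinite_Sum.abs_summable_on_Sigma_iff by simp
    then have summ: "(\<lambda>(z, k). f (fst z) (snd z) k) summable_on (UNIV \<times> UNIV)"
      by (rule abs_summable_summable)
    have "((\<lambda>(z, k). f (fst z) (snd z) k) has_sum u x t) (UNIV \<times> UNIV)"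
    proof (rule has_sum_SigmaI[OF _ _ summ])
      show "((\<lambda>k. case (z, k) of (z, k) \<Rightarrow> f (fst z) (snd z) k) has_sum
          (case z of (j, n) \<Rightarrow> a j n * ?X ^ j * t ^ n)) UNIV" for z
        using inner by (simp add: case_prod_unfold)
      show "((\<lambda>(j, n). a j n * ?X ^ j * t ^ n) has_sum u x t) UNIV"
        by (rule sum) (use x t in \<open>auto simp: r_def\<close>)
    qed
    \<comment> \<open>The triple sum is reordered to have \<open>n\<close> innermost, where it
      yields \<open>b j k\<close>.\<close>
    moreover have "bij_betw (\<lambda>((j, k), n). ((j, n), k)) (UNIV \<times> UNIV) ((UNIV :: (nat \<times> nat) set) \<times> (UNIV :: nat set))"
      by (rule bij_betwI[of _ _ _ "\<lambda>((j, n), k). ((j, k), n)"]) auto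
    ultimately have S: "((\<lambda>((j, k), n). f j n k) has_sum u x t) ((UNIV :: (nat \<times> nat) set) \<times> UNIV)"
      using has_sum_reindex_bij_betw[of "\<lambda>((j, k), n). ((j, n), k)" "UNIV \<times> UNIV" "UNIV \<times> UNIV"
          "\<lambda>(z, k). f (fst z) (snd z) k" "u x t"]
      by (simp add: case_prod_unfold)
    have terms: "((\<lambda>n. (\<lambda>((j, k), n). f j n k) (z, n)) has_sum
        (case z of (j, k) \<Rightarrow> b j k * ?X ^ j * ?T ^ k)) UNIV" for z
    proof -
      obtain j k where z: "z = (j, k)" by force
      have "(\<lambda>n. (\<lambda>((j, k), n). f j n k) (z, n)) summable_on UNIV"
        using summable_on_SigmaD1[of "\<lambda>z n. case (z, n) of ((j, k), n) \<Rightarrow> f j n k" UNIV "\<lambda>_. UNIV" z] S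
        by (auto simp: summable_on_def case_prod_unfold)
      then have "((\<lambda>n. f j n k) has_sum infsum (\<lambda>n. f j n k) UNIV) UNIV"
        by (simp add: z)
      also have "(\<lambda>n. f j n k) = (\<lambda>n. (?X ^ j * ?T ^ k) * (a j n * real (n choose k) * t0 ^ (n - k)))"
        by (simp add: f_def fun_eq_iff mult_ac)
      also have "infsum \<dots> UNIV = b j k * ?X ^ j * ?T ^ k"
        unfolding infsum_cmult_right' b_def by (simp add: mult_ac)
      finally show ?thesis
        by (simp add: z f_def mult_ac)
    qed
    show ?thesis
      using has_sum_SigmaD[OF S terms] by simp
  qed
  then show ?thesis
    unfolding real_analytic2_at_def using r by blast
qed

text \<open>Transfers facts about the x-derivative to the t-derivative.\<close>

lemma real_analytic2_at_swap:
  assumes "real_analytic2_at u x0 t0"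
  shows "real_analytic2_at (\<lambda>t x. u x t) t0 x0"
proof -
  obtain a r where r: "r > 0" and sum: "\<And>x t. \<lbrakk>\<bar>x - x0\<bar> < r; \<bar>t - t0\<bar> < r\<rbrakk> \<Longrightarrow>
       ((\<lambda>(m, n). a m n * (x - x0) ^ m * (t - t0) ^ n) has_sum u x t) (UNIV \<times> UNIV)"
    using assms unfolding real_analytic2_at_def UNIV_Times_UNIV by blast
  have "((\<lambda>(n, m). a m n * (t - t0) ^ n * (x - x0) ^ m) has_sum u x t) (UNIV \<times> UNIV)"
    if "\<bar>x - x0\<bar> < r" "\<bar>t - t0\<bar> < r" for x t
    using iffD1[OF has_sum_swap sum[OF that]] by (simp add: mult_ac)
  then show ?thesis
    unfolding real_analytic2_at_def
    by (intro exI[of _ "\<lambda>n m. a m n"] exI[of _ r]) (use r in auto)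
qed

text \<open>Weierstrass test on a closed square of half the size, the double series being enumerated
  by \<open>prod_decode\<close>.\<close>

lemma real_analytic2_at_isCont:
  assumes "real_analytic2_at u x0 t0"
  shows "isCont (\<lambda>(x, t). u x t) (x0, t0)"
proof -
  obtain a M s where s: "s > 0" and a: "\<And>m n. \<bar>a m n\<bar> \<le> M * s ^ m * s ^ n"
    and sum: "\<And>x t. \<lbrakk>\<bar>x - x0\<bar> < 1 / s; \<bar>t - t0\<bar> < 1 / s\<rbrakk> \<Longrightarrow>
       ((\<lambda>(m, n). a m n * (x - x0) ^ m * (t - t0) ^ n) has_sum u x t) UNIV"
    using assms by (rule real_analytic2_atE) blast
  let ?\<rho> = "1 / (2 * s)"
  define g where "g = (\<lambda>(m, n) (x, t). a m n * (x - x0) ^ m * (t - t0) ^ n)"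
  let ?f = "\<lambda>i z. g (prod_decode i) z"
  have rho: "?\<rho> > 0" "?\<rho> < 1 / s" using s by (auto simp: field_simps)
  let ?B = "cball x0 ?\<rho> \<times> cball t0 ?\<rho>"
  have reindex: "(\<lambda>i. h (prod_decode i)) sums S" if "(h has_sum S) UNIV" for h :: "nat \<times> nat \<Rightarrow> real" and S
    using has_sum_reindex_bij_betw[of prod_decode UNIV UNIV h S] that bij_prod_decode
    by (intro has_sum_imp_sums) auto
  have "uniform_limit ?B (\<lambda>n z. \<Sum>i<n. ?f i z) (\<lambda>z. \<Sum>i. ?f i z) sequentially"
  proof (rule Weierstrass_m_test)
    let ?h = "\<lambda>(m, n). \<bar>a m n\<bar> * ?\<rho> ^ m * ?\<rho> ^ n"
    have "?h summable_on UNIV"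
      by (rule summable_on_power_product[where M = M and \<rho> = s and \<sigma> = s]) (use a s rho in auto)
    then show "summable (\<lambda>i. ?h (prod_decode i))"
      using reindex[of ?h] by (auto simp: summable_on_def summable_def)
    show "norm (?f i z) \<le> ?h (prod_decode i)" if "z \<in> ?B" for i z
    proof -
      obtain m n where i: "prod_decode i = (m, n)" by force
      obtain x t where z: "z = (x, t)" by force
      have "\<bar>x - x0\<bar> ^ m \<le> ?\<rho> ^ m" "\<bar>t - t0\<bar> ^ n \<le> ?\<rho> ^ n"
        using that z by (auto intro!: power_mono simp: dist_norm abs_minus_commute)
      then have "\<bar>a m n\<bar> * \<bar>x - x0\<bar> ^ m * \<bar>t - t0\<bar> ^ n \<le> \<bar>a m n\<bar> * ?\<rho> ^ m * ?\<rho> ^ n"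
        using s by (intro mult_mono) auto
      then show ?thesis
        by (simp add: i z g_def abs_mult power_abs)
    qed
  qed
  then have "continuous_on ?B (\<lambda>z. \<Sum>i. ?f i z)"
  proof (rule uniform_limit_theorem[rotated])
    show "\<forall>\<^sub>F n in sequentially. continuous_on ?B (\<lambda>z. \<Sum>i<n. ?f i z)"
      unfolding g_def case_prod_unfold by (intro always_eventually allI continuous_intros)
  qed auto
  moreover have "(\<Sum>i. ?f i z) = (case z of (x, t) \<Rightarrow> u x t)" if "z \<in> ?B" for z
  proof -
    obtain x t where z: "z = (x, t)" by force
    have "((\<lambda>(m, n). a m n * (x - x0) ^ m * (t - t0) ^ n) has_sum u x t) UNIV"
      using that z rho by (intro sum) (auto simp: dist_norm abs_minus_commute)
    from reindex[OF this] show ?thesis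
      by (simp add: z g_def case_prod_unfold sums_iff)
  qed
  ultimately have "continuous_on ?B (\<lambda>(x, t). u x t)"
    by (rule continuous_on_eq)
  then have "continuous_on (ball x0 ?\<rho> \<times> ball t0 ?\<rho>) (\<lambda>(x, t). u x t)"
    by (rule continuous_on_subset) auto
  then show ?thesis
    using rho by (subst (asm) continuous_on_eq_continuous_at) (auto intro: open_Times)
qed

text \<open>Summing over \<open>n\<close> first leaves, for fixed t, a power series in x - x0 that
  can be differentiated termwise. The result is then reassembled as a double series, since joint
  analyticity is wanted.\<close>

lemma real_analytic2_at_deriv:
  assumes "real_analytic2_at u x0 t0"
  shows "((\<lambda>x. u x t0) has_real_derivative deriv (\<lambda>x. u x t0) x0) (at x0)"
    and "real_analytic2_at (\<lambda>x t. deriv (\<lambda>y. u y t) x) x0 t0"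
proof -
  obtain a M s where s: "s > 0" and a: "\<And>m n. \<bar>a m n\<bar> \<le> M * s ^ m * s ^ n"
    and sum0: "\<And>x t. \<lbrakk>\<bar>x - x0\<bar> < 1 / s; \<bar>t - t0\<bar> < 1 / s\<rbrakk> \<Longrightarrow>
       ((\<lambda>(m, n). a m n * (x - x0) ^ m * (t - t0) ^ n) has_sum u x t) UNIV"
    using assms by (rule real_analytic2_atE) blast
  have sum: "((\<lambda>(m, n). a m n * (x - x0) ^ m * (t - t0) ^ n) has_sum u x t) (UNIV \<times> UNIV)"
    if "\<bar>x - x0\<bar> < 1 / s" "\<bar>t - t0\<bar> < 1 / s" for x t
    using sum0[OF that] by simp
  define A where "A t m = (\<Sum>\<^sub>\<infinity>n. a m n * (t - t0) ^ n)" for t m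
  have Asum: "((\<lambda>n. a m n * (t - t0) ^ n) has_sum A t m) UNIV" if t: "\<bar>t - t0\<bar> < 1 / s" for t m
  proof -
    \<comment> \<open>The offset 1 / (2 * s) is just a nonzero value inside the radius; its power is
      cancelled afterwards.\<close>
    have "(\<lambda>z. case z of (m, n) \<Rightarrow> a m n * (1 / (2 * s)) ^ m * (t - t0) ^ n) summable_on UNIV \<times> UNIV"
      unfolding UNIV_Times_UNIV
      by (rule summable_on_power_product[where M = M and \<rho> = s and \<sigma> = s]) (use a s t in \<open>auto simp: field_simps\<close>)
    then have "(\<lambda>n. a m n * (1 / (2 * s)) ^ m * (t - t0) ^ n) summable_on UNIV"
      using summable_on_SigmaD1[of "\<lambda>m n. a m n * (1 / (2 * s)) ^ m * (t - t0) ^ n" UNIV "\<lambda>_. UNIV" m] by simp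
    then have "(\<lambda>n. (1 / (2 * s)) ^ m * (a m n * (t - t0) ^ n)) summable_on UNIV"
      by (simp add: mult_ac)
    then have "(\<lambda>n. a m n * (t - t0) ^ n) summable_on UNIV"
      using s by (subst (asm) summable_on_cmult_right') auto
    then show ?thesis
      unfolding A_def by simp
  qed
  have usum: "(\<lambda>m. A t m * (x - x0) ^ m) sums u x t"
    if "\<bar>t - t0\<bar> < 1 / s" "\<bar>x - x0\<bar> < 1 / s" for x t
  proof -
    have "((\<lambda>n. case (m, n) of (m, n) \<Rightarrow> a m n * (x - x0) ^ m * (t - t0) ^ n) has_sum A t m * (x - x0) ^ m) UNIV" for m
      using has_sum_cmult_left[OF Asum[OF that(1)], of m "(x - x0) ^ m"] by (simp add: mult_ac)
    then have "((\<lambda>m. A t m * (x - x0) ^ m) has_sum u x t) UNIV"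
      by (rule has_sum_SigmaD[OF sum[OF that(2,1)]])
    then show ?thesis by (rule has_sum_imp_sums)
  qed
  have D: "((\<lambda>y. u y t) has_real_derivative deriv (\<lambda>y. u y t) x) (at x)"
    "(\<lambda>m. diffs (A t) m * (x - x0) ^ m) sums deriv (\<lambda>y. u y t) x"
    if "\<bar>t - t0\<bar> < 1 / s" "\<bar>x - x0\<bar> < 1 / s" for x t
    using power_series_deriv[of x0 "1 / s" "A t" "\<lambda>y. u y t" x] usum that by auto
  show "((\<lambda>x. u x t0) has_real_derivative deriv (\<lambda>x. u x t0) x0) (at x0)"
    using D(1)[of t0 x0] s by simp
  define b where "b m n = real (Suc m) * a (Suc m) n" for m n
  have b: "\<bar>b m n\<bar> \<le> (M * s) * (2 * s) ^ m * s ^ n" for m n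
  proof -
    have M: "M \<ge> 0" using a[of 0 0] by simp
    \<comment> \<open>The factor from differentiation is absorbed by doubling the rate in x.\<close>
    have "real (Suc m) \<le> 2 ^ m"
      using of_nat_le_iff[of "Suc m" "2 ^ m", where ?'a = real] by (simp add: Suc_leI)
    then have "real (Suc m) * \<bar>a (Suc m) n\<bar> \<le> 2 ^ m * (M * s ^ Suc m * s ^ n)"
      by (intro mult_mono a) auto
    then show ?thesis
      by (simp add: b_def abs_mult power_mult_distrib mult_ac del: of_nat_Suc)
  qed
  have "((\<lambda>(m, n). b m n * (x - x0) ^ m * (t - t0) ^ n) has_sum deriv (\<lambda>y. u y t) x) (UNIV \<times> UNIV)"
    if x: "\<bar>x - x0\<bar> < 1 / (2 * s)" and t: "\<bar>t - t0\<bar> < 1 / (2 * s)" for x t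
  proof -
    have 2: "1 / (2 * s) < 1 / s" using s by (simp add: field_simps)
    have summ: "(\<lambda>(m, n). b m n * (x - x0) ^ m * (t - t0) ^ n) summable_on UNIV \<times> UNIV"
      unfolding UNIV_Times_UNIV
      by (rule summable_on_power_product[OF b]) (use s x t 2 in auto)
    have inner: "((\<lambda>n. case (m, n) of (m, n) \<Rightarrow> b m n * (x - x0) ^ m * (t - t0) ^ n) has_sum
        diffs (A t) m * (x - x0) ^ m) UNIV" for m
    proof -
      have "((\<lambda>n. a (Suc m) n * (t - t0) ^ n) has_sum A t (Suc m)) UNIV"
        using t 2 by (intro Asum) auto
      from has_sum_cmult_right[OF this, of "real (Suc m) * (x - x0) ^ m"] show ?thesis
        by (simp add: b_def diffs_def mult_ac del: of_nat_Suc)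
    qed
    obtain S where S: "((\<lambda>(m, n). b m n * (x - x0) ^ m * (t - t0) ^ n) has_sum S) (UNIV \<times> UNIV)"
      using summ unfolding summable_on_def by blast
    have "((\<lambda>m. diffs (A t) m * (x - x0) ^ m) has_sum S) UNIV"
      by (rule has_sum_SigmaD[OF S inner])
    then have "S = deriv (\<lambda>y. u y t) x"
      using D(2)[of t x] x t 2 has_sum_imp_sums sums_unique2 by (metis less_trans)
    then show ?thesis using S by simp
  qed
  then show "real_analytic2_at (\<lambda>x t. deriv (\<lambda>y. u y t) x) x0 t0"
    unfolding real_analytic2_at_def UNIV_Times_UNIV
    by (intro exI[of _ b] exI[of _ "1 / (2 * s)"]) (use s in auto)
qed

section \<open>Existence\<close>

lemma helmholtz_inverse_lincomb:
  assumes "periodic_2pi f" "continuous_on UNIV f" "periodic_2pi g" "continuous_on UNIV g"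
  shows "helmholtz_inverse (\<lambda>x. a * f x + b * g x) = (\<lambda>x. a * helmholtz_inverse f x + b * helmholtz_inverse g x)"
proof -
  obtain h k where "helmholtz_pair f (helmholtz_inverse f) h" "helmholtz_pair g (helmholtz_inverse g) k"
    using helmholtz_inverse_pair assms by metis
  then show ?thesis
    by (rule helmholtz_inverse_eq[OF helmholtz_pair_lincomb])
qed

text \<open>The sup bound makes the operator continuous under uniform convergence, so it may be
  applied term by term.\<close>

lemma helmholtz_inverse_sums:
  fixes f :: "nat \<Rightarrow> real \<Rightarrow> real"
  assumes per: "\<And>n. periodic_2pi (f n)" and cont: "\<And>n. continuous_on UNIV (f n)"
    and le: "\<And>n x. \<bar>f n x\<bar> \<le> g n" and g: "summable g"
  shows "periodic_2pi (\<lambda>x. \<Sum>n. f n x)" "continuous_on UNIV (\<lambda>x. \<Sum>n. f n x)"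
    and "(\<lambda>n. helmholtz_inverse (f n) x) sums helmholtz_inverse (\<lambda>x. \<Sum>n. f n x) x"
proof -
  let ?S = "\<lambda>x. \<Sum>n. f n x" and ?P = "\<lambda>N x. \<Sum>n<N. f n x"
  show S1: "periodic_2pi ?S"
    using per by (simp add: periodic_2pi_def)
  have lim: "uniform_limit UNIV ?P ?S sequentially"
    by (rule Weierstrass_m_test[OF _ g]) (use le in auto)
  have P: "periodic_2pi (?P N)" "continuous_on UNIV (?P N)" for N
    using per by (auto simp: periodic_2pi_def intro!: continuous_intros cont)
  show S2: "continuous_on UNIV ?S"
    using P by (intro uniform_limit_theorem[OF _ lim]) auto
  have HP: "helmholtz_inverse (?P N) = (\<lambda>x. \<Sum>n<N. helmholtz_inverse (f n) x)" for N
  proof (induction N)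
    case 0
    then show ?case
      using helmholtz_inverse_lincomb[OF per cont per cont, of 0 0 0 0] by simp
  next
    case (Suc N)
    then show ?case
      using helmholtz_inverse_lincomb[OF P[of N] per[of N] cont[of N], of 1 1] by simp
  qed
  show "(\<lambda>n. helmholtz_inverse (f n) x) sums helmholtz_inverse ?S x"
    unfolding sums_def tendsto_iff
  proof (intro allI impI)
    fix e :: real assume e: "e > 0"
    then have "\<forall>\<^sub>F N in sequentially. \<forall>x\<in>UNIV. dist (?P N x) (?S x) < e / 2"
      using lim[unfolded uniform_limit_iff, rule_format, of "e / 2"] by simp
    then show "\<forall>\<^sub>F N in sequentially. dist (\<Sum>n<N. helmholtz_inverse (f n) x) (helmholtz_inverse ?S x) < e"
    proof eventually_elim
      case (elim N)
      have "\<bar>helmholtz_inverse (\<lambda>x. 1 * ?P N x + (- 1) * ?S x) x\<bar> \<le> e / 2"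
      proof (rule helmholtz_inverse_bound)
        show "periodic_2pi (\<lambda>x. 1 * ?P N x + (- 1) * ?S x)"
          using P(1)[of N] S1 by (simp add: periodic_2pi_def)
        show "continuous_on UNIV (\<lambda>x. 1 * ?P N x + (- 1) * ?S x)"
          by (intro continuous_on_add continuous_on_mult_left P S2)
        show "\<bar>1 * ?P N x + (- 1) * ?S x\<bar> \<le> e / 2" for x
          using elim by (auto simp: dist_norm intro: less_imp_le)
      qed
      then show ?case
        unfolding helmholtz_inverse_lincomb[OF P[of N] S1 S2, of 1 "- 1"] HP
        using e by (simp add: dist_norm)
    qed
  qed
qed

lemma summable_geometric_bound:
  fixes b :: "nat \<Rightarrow> real"
  assumes b: "\<And>n. \<bar>b n\<bar> \<le> M * \<rho> ^ n" and "\<rho> > 0" and X: "\<bar>X\<bar> < 1 / \<rho>"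
  shows "summable (\<lambda>n. norm (b n * X ^ n))"
proof (rule summable_comparison_test[OF exI[of _ 0]], intro allI impI)
  show "summable (\<lambda>n. M * (\<rho> * \<bar>X\<bar>) ^ n)"
    using assms by (intro summable_mult summable_geometric) (auto simp: field_simps)
  show "norm (norm (b n * X ^ n)) \<le> M * (\<rho> * \<bar>X\<bar>) ^ n" for n
    using mult_right_mono[OF b[of n], of "\<bar>X\<bar> ^ n"]
    by (simp add: abs_mult power_abs power_mult_distrib mult_ac)
qed

text \<open>The Lagrange remainder F n (\<xi> + x) X^n tends to 0 geometrically; as \<xi> is
  unknown, the bound is assumed at all points.\<close>

lemma taylor_tower_sums:
  assumes F: "taylor_tower F" and b: "\<And>j y. \<bar>F j y\<bar> \<le> M * \<rho> ^ j" and "\<rho> > 0" and X: "\<bar>X\<bar> < 1 / \<rho>"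
  shows "(\<lambda>j. F j x * X ^ j) sums F 0 (x + X)"
proof -
  define d where "d m y = fact m * F m (y + x)" for m y
  have d: "(d m has_real_derivative d (Suc m) y) (at y)" for m y
  proof -
    have "((\<lambda>y. F m (y + x)) has_real_derivative real (Suc m) * F (Suc m) (y + x)) (at y)"
      using F unfolding taylor_tower_def DERIV_shift[symmetric] by blast
    from DERIV_cmult[OF this, of "fact m"] show ?thesis
      by (simp add: d_def[abs_def] mult_ac del: of_nat_Suc)
  qed
  have remainder: "\<bar>(\<Sum>j<n. F j x * X ^ j) - F 0 (x + X)\<bar> \<le> M * (\<rho> * \<bar>X\<bar>) ^ n" for n
  proof -
    obtain \<xi> where "d 0 X = (\<Sum>m<n. (d m 0 / fact m) * X ^ m) + (d n \<xi> / fact n) * X ^ n"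
      using Maclaurin_all_le[of d "d 0" X n] d by auto
    then have "F 0 (x + X) = (\<Sum>m<n. F m x * X ^ m) + F n (\<xi> + x) * X ^ n"
      by (simp add: d_def add.commute)
    then have "\<bar>(\<Sum>j<n. F j x * X ^ j) - F 0 (x + X)\<bar> = \<bar>F n (\<xi> + x)\<bar> * \<bar>X\<bar> ^ n"
      by (simp add: abs_mult power_abs)
    also have "\<dots> \<le> M * \<rho> ^ n * \<bar>X\<bar> ^ n"
      by (intro mult_right_mono b) auto
    finally show ?thesis by (simp add: power_mult_distrib mult_ac)
  qed
  have "(\<lambda>n. M * (\<rho> * \<bar>X\<bar>) ^ n) \<longlonglongrightarrow> 0"
    using assms by (intro tendsto_mult_right_zero LIMSEQ_realpow_zero) (auto simp: field_simps)
  then have "(\<lambda>n. (\<Sum>j<n. F j x * X ^ j) - F 0 (x + X)) \<longlonglongrightarrow> 0"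
    by (rule Lim_null_comparison[rotated]) (use remainder in simp)
  then show ?thesis
    unfolding sums_def by (rule LIM_zero_cancel)
qed

text \<open>Decouples j from n, at the price of doubled rates, so that products of geometric series
  suffice for convergence.\<close>

lemma FW_coeff_geometric_bound:
  assumes F: "taylor_tower F" and per: "periodic_2pi (F 0)" and A: "A > 0" and R: "R > 0"
    and bound: "\<And>j x. \<bar>F j x\<bar> \<le> A * R ^ j * weight j"
  shows "\<bar>FW_coeff F n j x\<bar> \<le> A * (2 * R) ^ j * (2 * (R + 6 * A * R)) ^ n"
proof -
  let ?B = "R + 6 * A * R"
  have B: "?B > 0" using A R by (simp add: add_pos_pos)
  have "real (n + j choose j) \<le> 2 ^ (n + j)"
    using binomial_le_pow2[of "n + j" j] by (metis of_nat_le_iff of_nat_numeral of_nat_power)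
  moreover have "weight (n + j) \<le> 1"
    by (simp add: weight_def)
  ultimately have "real (n + j choose j) * weight (n + j) \<le> 2 ^ (n + j) * 1"
    using weight_pos[of "n + j"] by (intro mult_mono) auto
  then have "A * R ^ j * ?B ^ n * (real (n + j choose j) * weight (n + j)) \<le> A * R ^ j * ?B ^ n * (2 ^ (n + j) * 1)"
    using A R B by (intro mult_left_mono) auto
  also have "\<dots> = A * (2 * R) ^ j * (2 * ?B) ^ n"
    by (simp only: power_mult_distrib power_add mult_ac mult_1_left mult_1_right)
  finally show ?thesis
    using FW_coeff_bound[OF assms, of n j x] by (simp add: mult.assoc)
qed

lemma analytic_FW_solution_exists:
  assumes per: "periodic_2pi u0" and an: "\<And>x. real_analytic_at u0 x"
  shows "\<exists>\<epsilon>>0. \<exists>u. analytic_FW_solution u0 \<epsilon> u"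
proof -
  obtain F A R where F: "taylor_tower F" "F 0 = u0" and A: "A > 0" and R: "R > 0"
    and le: "\<And>j x. \<bar>F j x\<bar> \<le> A * R ^ j / (real j + 1)\<^sup>2"
    using real_analytic_taylor_tower[OF assms] by blast
  define c where "c = FW_coeff F"
  define \<rho> where "\<rho> = 2 * R"
  define \<sigma> where "\<sigma> = 2 * (R + 6 * A * R)"
  have rs: "\<rho> > 0" "\<sigma> > 0"
    using A R by (simp_all add: \<rho>_def \<sigma>_def add_pos_pos)
  have bound: "\<bar>c n j x\<bar> \<le> A * \<rho> ^ j * \<sigma> ^ n" for n j x
    unfolding c_def \<rho>_def \<sigma>_def
    by (rule FW_coeff_geometric_bound) (use F per A R le in \<open>auto simp: weight_def\<close>)
  have tow: "taylor_tower (c n)" and cper: "periodic_2pi (c n j)" for n j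
    using taylor_tower_FW_coeff[OF F(1)] F(2) per by (auto simp: c_def)
  have ccont: "continuous_on UNIV (c n j)" for n j
    using tow by (rule taylor_tower_continuous)
  \<comment> \<open>\<open>U j x t\<close> is to be the coefficient of (y - x)^j in u (y, t), and
    \<open>U 0\<close> the solution. The life span 1 / \<sigma> is the radius given by the geometric
    bound.\<close>
  define U where "U j x t = (\<Sum>n. c n j x * t ^ n)" for j x t
  let ?\<epsilon> = "1 / \<sigma>" and ?u = "U 0"
  have summ: "summable (\<lambda>n. norm (c n j x * t ^ n))" if "\<bar>t\<bar> < ?\<epsilon>" for j x t
    using bound rs that by (intro summable_geometric_bound[of _ "A * \<rho> ^ j" \<sigma>])
  have U: "(\<lambda>n. c n j x * t ^ n) sums U j x t" if "\<bar>t\<bar> < ?\<epsilon>" for j x t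
    unfolding U_def using summable_norm_cancel[OF summ[OF that]] by (rule summable_sums)
  \<comment> \<open>Summing over \<open>j\<close> first restores \<open>c n 0 y\<close> by
    \<open>taylor_tower_sums\<close>; the sum over \<open>n\<close> is then u (y, t).\<close>
  have double: "((\<lambda>(j, n). c n j x * (y - x) ^ j * t ^ n) has_sum ?u y t) (UNIV \<times> UNIV)"
    if y: "\<bar>y - x\<bar> < 1 / \<rho>" and t: "\<bar>t\<bar> < ?\<epsilon>" for x y t
  proof -
    have "(\<lambda>(n, j). c n j x * t ^ n * (y - x) ^ j) summable_on UNIV \<times> UNIV"
      unfolding UNIV_Times_UNIV
      by (rule summable_on_power_product[where M = A and \<rho> = \<sigma> and \<sigma> = \<rho>])
         (use bound rs y t in \<open>auto simp: mult_ac\<close>)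
    then have "((\<lambda>(n, j). c n j x * t ^ n * (y - x) ^ j) has_sum ?u y t) (UNIV \<times> UNIV)"
    proof (rule has_sum_SigmaI[rotated 2])
      show "((\<lambda>n. c n 0 y * t ^ n) has_sum ?u y t) UNIV"
        by (rule norm_summable_imp_has_sum[OF summ[OF t] U[OF t]])
      fix n
      have b: "\<bar>c n j z\<bar> \<le> (A * \<sigma> ^ n) * \<rho> ^ j" for j z
        using bound[of n j z] by (simp add: mult_ac)
      have "((\<lambda>j. c n j x * (y - x) ^ j) has_sum c n 0 y) UNIV"
        using summable_geometric_bound[OF b rs(1) y] taylor_tower_sums[OF tow b rs(1) y, of x]
        by (intro norm_summable_imp_has_sum) auto
      from has_sum_cmult_left[OF this, of "t ^ n"]
      show "((\<lambda>j. case (n, j) of (n, j) \<Rightarrow> c n j x * t ^ n * (y - x) ^ j) has_sum c n 0 y * t ^ n) UNIV"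
        by (simp add: mult_ac)
    qed
    from iffD1[OF has_sum_swap this] show ?thesis
      by (simp add: mult_ac)
  qed
  \<comment> \<open>The same double series summed over \<open>n\<close> first is a power series in y
    - x, and its coefficient of index 1 is the derivative.\<close>
  have dx: "deriv (\<lambda>y. ?u y t) x = U 1 x t" if t: "\<bar>t\<bar> < ?\<epsilon>" for x t
  proof -
    have "(\<lambda>j. U j x t * (y - x) ^ j) sums ?u y t" if y: "\<bar>y - x\<bar> < 1 / \<rho>" for y
    proof -
      have "((\<lambda>n. case (j, n) of (j, n) \<Rightarrow> c n j x * (y - x) ^ j * t ^ n) has_sum U j x t * (y - x) ^ j) UNIV" for j
        using has_sum_cmult_left[OF norm_summable_imp_has_sum[OF summ[OF t] U[OF t]], of j x "(y - x) ^ j"]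
        by (simp add: mult_ac)
      then have "((\<lambda>j. U j x t * (y - x) ^ j) has_sum ?u y t) UNIV"
        by (rule has_sum_SigmaD[OF double[OF y t]])
      then show ?thesis by (rule has_sum_imp_sums)
    qed
    then have "(\<lambda>n. diffs (\<lambda>j. U j x t) n * (x - x) ^ n) sums deriv (\<lambda>y. ?u y t) x"
      by (rule power_series_deriv(2)[where r = "1 / \<rho>"]) (use rs in auto)
    then show ?thesis
      using powser_sums_zero[of "diffs (\<lambda>j. U j x t)"] sums_unique2
      by (fastforce simp: diffs_def)
  qed
  have dt: "(\<lambda>n. diffs (\<lambda>n. c n 0 x) n * t ^ n) sums deriv (\<lambda>s. ?u x s) t" if t: "\<bar>t\<bar> < ?\<epsilon>" for x t
    using power_series_deriv(2)[of 0 ?\<epsilon> "\<lambda>n. c n 0 x" "?u x" t] U[of _ 0 x] t by simp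
  have eq: "FW_equation_at ?u x t" if t: "\<bar>t\<bar> < ?\<epsilon>" for x t
  proof -
    let ?f = "\<lambda>n y. c n 1 y * t ^ n"
    have f: "periodic_2pi (?f n)" "continuous_on UNIV (?f n)" "\<bar>?f n y\<bar> \<le> A * \<rho> * (\<sigma> * \<bar>t\<bar>) ^ n" for n y
    proof -
      show "periodic_2pi (?f n)" using cper by (simp add: periodic_2pi_def)
      show "continuous_on UNIV (?f n)" by (intro continuous_intros ccont)
      show "\<bar>?f n y\<bar> \<le> A * \<rho> * (\<sigma> * \<bar>t\<bar>) ^ n"
        using mult_right_mono[OF bound[of n 1 y], of "\<bar>t\<bar> ^ n"]
        by (simp add: abs_mult power_abs power_mult_distrib mult_ac)
    qed
    have "summable (\<lambda>n. A * \<rho> * (\<sigma> * \<bar>t\<bar>) ^ n)"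
      using rs t by (intro summable_mult summable_geometric) (auto simp: field_simps)
    note hs = helmholtz_inverse_sums[of ?f, OF f this]
    have Ux: "(\<lambda>y. \<Sum>n. ?f n y) = (\<lambda>y. deriv (\<lambda>y. ?u y t) y)"
      using dx[OF t] by (simp add: U_def)
    let ?H = "helmholtz_inverse (\<lambda>y. deriv (\<lambda>y. ?u y t) y) x"
    have "helmholtz_inverse (?f n) x = helmholtz_inverse (c n 1) x * t ^ n" for n
      using fun_cong[OF helmholtz_inverse_lincomb[OF cper ccont cper ccont, where a = "t ^ n" and b = 0], of n 1 _ _ x]
      by (simp add: mult.commute)
    then have H: "(\<lambda>n. helmholtz_inverse (c n 1) x * t ^ n) sums ?H"
      using hs(3)[of x] unfolding Ux by simp
    have prod: "(\<lambda>n. (\<Sum>i\<le>n. c i j x * c (n - i) k x) * t ^ n) sums (U j x t * U k x t)" for j k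
    proof -
      have "(\<lambda>n. \<Sum>i\<le>n. (c i j x * t ^ i) * (c (n - i) k x * t ^ (n - i))) sums (U j x t * U k x t)"
        unfolding U_def by (rule Cauchy_product_sums[OF summ summ]) (use t in auto)
      also have "(\<lambda>n. \<Sum>i\<le>n. (c i j x * t ^ i) * (c (n - i) k x * t ^ (n - i))) =
          (\<lambda>n. (\<Sum>i\<le>n. c i j x * c (n - i) k x) * t ^ n)"
      proof
        fix n
        have pw: "(c i j x * t ^ i) * (c (n - i) k x * t ^ (n - i)) = c i j x * c (n - i) k x * t ^ n" if "i \<le> n" for i
          using that power_add[of t i "n - i"] by (simp add: mult_ac)
        show "(\<Sum>i\<le>n. (c i j x * t ^ i) * (c (n - i) k x * t ^ (n - i))) = (\<Sum>i\<le>n. c i j x * c (n - i) k x) * t ^ n"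
          unfolding sum_distrib_right by (intro sum.cong refl pw) simp
      qed
      finally show ?thesis .
    qed
    \<comment> \<open>For j = 0 the inner sum consists of l = 0 and l = 1, the two halves u u_x +
      u_x u of the derivative of u^2; this turns 3/4 into 3/2.\<close>
    have rec: "of_nat (Suc n) * c (Suc n) 0 x = helmholtz_inverse (c n 1) x -
        3 / 4 * ((\<Sum>i\<le>n. c i 0 x * c (n - i) 1 x) + (\<Sum>i\<le>n. c i 1 x * c (n - i) 0 x))" for n
      unfolding c_def FW_coeff.simps
      by (simp add: sum.distrib of_nat_1[unfolded One_nat_def] del: of_nat_Suc)
    have "(\<lambda>n. helmholtz_inverse (c n 1) x * t ^ n - 3 / 4 * ((\<Sum>i\<le>n. c i 0 x * c (n - i) 1 x) * t ^ n +
        (\<Sum>i\<le>n. c i 1 x * c (n - i) 0 x) * t ^ n)) sums (?H - 3 / 4 * (U 0 x t * U 1 x t + U 1 x t * U 0 x t))"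
      by (intro sums_diff sums_mult sums_add H prod)
    also have "(\<lambda>n. helmholtz_inverse (c n 1) x * t ^ n - 3 / 4 * ((\<Sum>i\<le>n. c i 0 x * c (n - i) 1 x) * t ^ n +
        (\<Sum>i\<le>n. c i 1 x * c (n - i) 0 x) * t ^ n)) = (\<lambda>n. diffs (\<lambda>n. c n 0 x) n * t ^ n)"
      unfolding diffs_def rec by (simp add: algebra_simps)
    finally have "deriv (\<lambda>s. ?u x s) t = ?H - 3 / 4 * (U 0 x t * U 1 x t + U 1 x t * U 0 x t)"
      using dt[OF t] sums_unique2 by blast
    then have "deriv (\<lambda>s. ?u x s) t + 3 / 2 * ?u x t * deriv (\<lambda>y. ?u y t) x = ?H"
      unfolding dx[OF t] by (simp add: algebra_simps)
    moreover have "inv_helmholtz (\<lambda>z. complex_of_real (deriv (\<lambda>y. ?u y t) z)) x = of_real ?H"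
      using hs(1,2) unfolding Ux by (rule inv_helmholtz_conv_helmholtz_inverse)
    ultimately show ?thesis
      unfolding FW_equation_at_def by simp
  qed
  have init: "?u x 0 = u0 x" for x
    using powser_sums_zero[of "\<lambda>n. c n 0 x"] F(2) by (simp add: U_def sums_iff c_def)
  have "real_analytic2_at ?u x t" if t: "\<bar>t\<bar> < ?\<epsilon>" for x t
  proof (rule real_analytic2_atI[where a = "\<lambda>j n. c n j x"])
    show "((\<lambda>(j, n). c n j x * (y - x) ^ j * s ^ n) has_sum ?u y s) UNIV"
      if "\<bar>y - x\<bar> < 1 / \<rho>" "\<bar>s\<bar> < ?\<epsilon>" for y s
      using double[OF that] by simp
  qed (use bound rs t in auto)
  moreover have "periodic_2pi (\<lambda>x. ?u x t)" for t
    using cper by (simp add: U_def periodic_2pi_def)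
  ultimately have "analytic_FW_solution u0 ?\<epsilon> ?u"
    unfolding analytic_FW_solution_def using eq init by (auto simp: abs_less_iff)
  moreover have "?\<epsilon> > 0" using rs by simp
  ultimately show ?thesis by blast
qed

section \<open>Uniqueness\<close>

lemma real_analytic2_continuous_on:
  assumes "\<And>x t. \<lbrakk>x \<in> S; t \<in> T\<rbrakk> \<Longrightarrow> real_analytic2_at f x t"
  shows "continuous_on (S \<times> T) (\<lambda>z. f (fst z) (snd z))"
proof (rule continuous_at_imp_continuous_on, rule ballI)
  fix z assume "z \<in> S \<times> T"
  then show "isCont (\<lambda>z. f (fst z) (snd z)) z"
    using real_analytic2_at_isCont[OF assms, of "fst z" "snd z"]
    by (auto simp: case_prod_unfold)
qed

text \<open>The two-sided bound on \<open>E'\<close> serves both time directions: E t * exp (- K *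
  t) is nonincreasing after 0, and E t * exp (K * t) is nondecreasing before 0.\<close>

lemma gronwall_zero:
  fixes E E' :: "real \<Rightarrow> real"
  assumes der: "\<And>t. \<bar>t\<bar> \<le> \<tau> \<Longrightarrow> (E has_real_derivative E' t) (at t)"
    and le: "\<And>t. \<bar>t\<bar> \<le> \<tau> \<Longrightarrow> \<bar>E' t\<bar> \<le> K * E t"
    and E0: "E 0 = 0" and s: "\<bar>s\<bar> \<le> \<tau>"
  shows "E s \<le> 0"
proof (cases "s \<ge> 0")
  case True
  have "E s * exp (- K * s) \<le> E 0 * exp (- K * 0)"
  proof (rule DERIV_nonpos_imp_nonincreasing[OF True])
    fix t assume t: "0 \<le> t" "t \<le> s"
    then have "\<bar>t\<bar> \<le> \<tau>" using s by simp
    then have "((\<lambda>t. E t * exp (- K * t)) has_real_derivative (E' t - K * E t) * exp (- K * t)) (at t)"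
      and "E' t - K * E t \<le> 0"
      using der le[of t] by (auto intro!: derivative_eq_intros simp: algebra_simps)
    then show "\<exists>y. ((\<lambda>t. E t * exp (- K * t)) has_real_derivative y) (at t) \<and> y \<le> 0"
      by (meson exp_ge_zero mult_nonpos_nonneg)
  qed
  then show ?thesis using E0 by (simp add: mult_le_0_iff)
next
  case False
  have "E s * exp (K * s) \<le> E 0 * exp (K * 0)"
  proof (rule DERIV_nonneg_imp_nondecreasing[of s 0 "\<lambda>t. E t * exp (K * t)"])
    show "s \<le> 0" using False by simp
    fix t assume t: "s \<le> t" "t \<le> 0"
    then have "\<bar>t\<bar> \<le> \<tau>" using s by simp
    then have "((\<lambda>t. E t * exp (K * t)) has_real_derivative (E' t + K * E t) * exp (K * t)) (at t)"
      and "E' t + K * E t \<ge> 0"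
      using der le[of t] by (auto intro!: derivative_eq_intros simp: algebra_simps)
    then show "\<exists>y. ((\<lambda>t. E t * exp (K * t)) has_real_derivative y) (at t) \<and> y \<ge> 0"
      by (meson exp_ge_zero mult_nonneg_nonneg)
  qed
  then show ?thesis using E0 by (simp add: mult_le_0_iff)
qed

text \<open>With \<open>w = u - v\<close>, \<open>s = u + v\<close> and \<open>g - g'' = w\<close> one has
  \<open>2 w w\<^sub>t = \<partial>\<^sub>x (g\<^sup>2 - g'\<^sup>2 - 3/4 w\<^sup>2 s) - 3/4 w\<^sup>2 s\<^sub>x\<close>.\<close>

lemma FW_energy_identity:
  assumes u: "periodic_2pi u" "\<And>x. (u has_real_derivative ux x) (at x)" "continuous_on UNIV ux"
    and v: "periodic_2pi v" "\<And>x. (v has_real_derivative vx x) (at x)" "continuous_on UNIV vx"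
    and ut: "\<And>x. ut x + 3 / 2 * u x * ux x = helmholtz_inverse ux x"
    and vt: "\<And>x. vt x + 3 / 2 * v x * vx x = helmholtz_inverse vx x"
  shows "((\<lambda>x. 2 * (u x - v x) * (ut x - vt x) + 3 / 4 * ((u x - v x)\<^sup>2 * (ux x + vx x))) has_integral 0) {0..2 * pi}"
proof -
  let ?w = "\<lambda>x. u x - v x"
  have wper: "periodic_2pi ?w"
    using u v by (simp add: periodic_2pi_def)
  have w: "(?w has_real_derivative ux x - vx x) (at x)" for x
    by (intro DERIV_diff u v)
  have "continuous_on UNIV ?w"
    using w by (meson DERIV_isCont continuous_at_imp_continuous_on)
  then obtain g' where g: "helmholtz_pair ?w (helmholtz_inverse ?w) g'"
    using helmholtz_inverse_pair[OF wper] by metis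
  define g where "g = helmholtz_inverse ?w"
  have pair: "helmholtz_pair ?w g g'" using g by (simp add: g_def)
  have gd: "(g has_real_derivative g' x) (at x)" "(g' has_real_derivative g x - ?w x) (at x)" for x
    using pair by (auto simp: helmholtz_pair_def)
  have gper: "periodic_2pi g" "periodic_2pi g'"
    using pair helmholtz_pair_periodic_deriv[OF pair] by (auto simp: helmholtz_pair_def)
  have "helmholtz_pair (\<lambda>x. ux x - vx x) g' (\<lambda>x. g x - ?w x)"
    by (rule helmholtz_pair_deriv[OF pair w]) (intro continuous_intros u v)
  \<comment> \<open>Commutation identifies \<open>g'\<close> with the difference of the nonlocal
    terms. It enters the energy as 2 w g' = (g^2 - g'^2)', an exact derivative, because w = g -
    g''.\<close>
  then have "g' = helmholtz_inverse (\<lambda>x. 1 * ux x + (- 1) * vx x)"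
    using helmholtz_inverse_eq by simp
  also have "\<dots> = (\<lambda>x. 1 * helmholtz_inverse ux x + (- 1) * helmholtz_inverse vx x)"
    by (intro helmholtz_inverse_lincomb u v periodic_2pi_deriv[OF u(1,2)] periodic_2pi_deriv[OF v(1,2)])
  finally have g'_eq: "g' x = helmholtz_inverse ux x - helmholtz_inverse vx x" for x
    by simp
  define Q where "Q x = (g x)\<^sup>2 - (g' x)\<^sup>2 - 3 / 4 * ((?w x)\<^sup>2 * (u x + v x))" for x
  have Q: "(Q has_real_derivative
      2 * (u x - v x) * (ut x - vt x) + 3 / 4 * ((u x - v x)\<^sup>2 * (ux x + vx x))) (at x)" for x
  proof -
    have "(Q has_real_derivative 2 * g x * g' x - 2 * g' x * (g x - ?w x) -
        3 / 4 * (2 * ?w x * (ux x - vx x) * (u x + v x) + (?w x)\<^sup>2 * (ux x + vx x))) (at x)"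
      unfolding Q_def by (auto intro!: derivative_eq_intros gd u v simp: field_simps power2_eq_square)
    moreover have utvt: "ut x = helmholtz_inverse ux x - 3 / 2 * u x * ux x" "vt x = helmholtz_inverse vx x - 3 / 2 * v x * vx x"
      using ut[of x] vt[of x] by simp_all
    have "2 * g x * g' x - 2 * g' x * (g x - ?w x) -
        3 / 4 * (2 * ?w x * (ux x - vx x) * (u x + v x) + (?w x)\<^sup>2 * (ux x + vx x)) =
        2 * (u x - v x) * (ut x - vt x) + 3 / 4 * ((u x - v x)\<^sup>2 * (ux x + vx x))"
      unfolding g'_eq utvt by (simp add: field_simps power2_eq_square)
    ultimately show ?thesis by simp
  qed
  have "((\<lambda>x. 2 * (u x - v x) * (ut x - vt x) + 3 / 4 * ((u x - v x)\<^sup>2 * (ux x + vx x)))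
      has_integral (Q (2 * pi) - Q 0)) {0..2 * pi}"
    using Q by (intro fundamental_theorem_of_calculus)
      (auto simp: has_real_derivative_iff_has_vector_derivative intro: has_vector_derivative_at_within)
  moreover have "Q (2 * pi) = Q 0"
    using periodic_2pi_of_int[OF gper(1), of 0 1] periodic_2pi_of_int[OF gper(2), of 0 1]
      periodic_2pi_of_int[OF u(1), of 0 1] periodic_2pi_of_int[OF v(1), of 0 1]
    by (simp add: Q_def)
  ultimately show ?thesis by simp
qed

lemma analytic_FW_solution_unique:
  assumes u: "analytic_FW_solution u0 \<epsilon> u" and v: "analytic_FW_solution u0 \<epsilon> v"
    and t: "t \<in> {-\<epsilon><..<\<epsilon>}"
  shows "u x t = v x t"
proof -
  let ?I = "{-\<epsilon><..<\<epsilon>}"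
  define dx where "dx f x t = deriv (\<lambda>y. f y t) x" for f :: "real \<Rightarrow> real \<Rightarrow> real" and x t
  define dt where "dt f x t = deriv (\<lambda>s. f x s) t" for f :: "real \<Rightarrow> real \<Rightarrow> real" and x t
  have sol: "periodic_2pi (\<lambda>x. f x t)" "((\<lambda>x. f x t) has_real_derivative dx f x t) (at x)"
    "(f x has_real_derivative dt f x t) (at t)"
    "real_analytic2_at f x t" "real_analytic2_at (dx f) x t" "real_analytic2_at (dt f) x t"
    if f: "analytic_FW_solution u0 \<epsilon> f" and t: "t \<in> ?I" for f x t
  proof -
    show "periodic_2pi (\<lambda>x. f x t)" and an: "real_analytic2_at f x t"
      using f t by (auto simp: analytic_FW_solution_def)
    show "((\<lambda>x. f x t) has_real_derivative dx f x t) (at x)" "real_analytic2_at (dx f) x t"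
      using real_analytic2_at_deriv[OF an] by (simp_all add: dx_def[abs_def])
    have "real_analytic2_at (\<lambda>t x. f x t) t x"
      using an by (rule real_analytic2_at_swap)
    note real_analytic2_at_deriv[OF this]
    then show "(f x has_real_derivative dt f x t) (at t)" "real_analytic2_at (dt f) x t"
      using real_analytic2_at_swap by (auto simp: dt_def[abs_def])
  qed
  have dx_cont: "continuous_on UNIV (\<lambda>x. dx f x t)"
    if f: "analytic_FW_solution u0 \<epsilon> f" and t: "t \<in> ?I" for f t
  proof -
    have "continuous_on (UNIV \<times> {t}) (\<lambda>z. dx f (fst z) (snd z))"
      by (rule real_analytic2_continuous_on) (use sol(5)[OF f] t in auto)
    moreover have "continuous_on UNIV (\<lambda>x. (x, t))"
      by (intro continuous_intros)
    ultimately have "continuous_on UNIV (\<lambda>x. dx f (fst (x, t)) (snd (x, t)))"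
      by (rule continuous_on_compose2) auto
    then show ?thesis by simp
  qed
  have eq: "dt f x t + 3 / 2 * f x t * dx f x t = helmholtz_inverse (\<lambda>x. dx f x t) x"
    if f: "analytic_FW_solution u0 \<epsilon> f" and t: "t \<in> ?I" for f x t
  proof -
    have "inv_helmholtz (\<lambda>z. complex_of_real (dx f z t)) x = of_real (helmholtz_inverse (\<lambda>x. dx f x t) x)"
      by (rule inv_helmholtz_conv_helmholtz_inverse)
         (use periodic_2pi_deriv[OF sol(1,2)[OF f t]] dx_cont[OF f t] in auto)
    moreover have "FW_equation_at f x t"
      using f t by (simp add: analytic_FW_solution_def)
    ultimately show ?thesis
      unfolding FW_equation_at_def dx_def dt_def by (metis of_real_eq_iff)
  qed
  define E where "E t = integral {0..2 * pi} (\<lambda>x. (u x t - v x t)\<^sup>2)" for t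
  define E' where "E' t = integral {0..2 * pi} (\<lambda>x. 2 * (u x t - v x t) * (dt u x t - dt v x t))" for t
  \<comment> \<open>Pairs are ordered (t, x), as differentiation under the integral expects the
    parameter first.\<close>
  have cont: "continuous_on (?I \<times> S) (\<lambda>z. f (snd z) (fst z))"
    if "\<And>x t. t \<in> ?I \<Longrightarrow> real_analytic2_at f x t" for f S
    using real_analytic2_continuous_on[of ?I S "\<lambda>t x. f x t"] real_analytic2_at_swap that by blast
  have contx: "continuous_on S (\<lambda>x. f x t)"
    if an: "\<And>x t. t \<in> ?I \<Longrightarrow> real_analytic2_at f x t" and t: "t \<in> ?I" for f t S
  proof -
    have "continuous_on S (\<lambda>x. (t, x))"
      by (intro continuous_intros)
    with cont[OF an, of S] have "continuous_on S (\<lambda>x. f (snd (t, x)) (fst (t, x)))"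
      by (rule continuous_on_compose2) (use t in auto)
    then show ?thesis by simp
  qed
  note cont = cont[OF sol(4)[OF u]] cont[OF sol(5)[OF u]] cont[OF sol(6)[OF u]]
    cont[OF sol(4)[OF v]] cont[OF sol(5)[OF v]] cont[OF sol(6)[OF v]]
  note contx = contx[OF sol(4)[OF u]] contx[OF sol(5)[OF u]] contx[OF sol(6)[OF u]]
    contx[OF sol(4)[OF v]] contx[OF sol(5)[OF v]] contx[OF sol(6)[OF v]]
  have derE: "(E has_real_derivative E' t) (at t)" if t: "t \<in> ?I" for t
  proof -
    have "((\<lambda>t. integral (cbox 0 (2 * pi)) (\<lambda>x. (u x t - v x t)\<^sup>2)) has_field_derivative
        integral (cbox 0 (2 * pi)) (\<lambda>x. 2 * (u x t - v x t) * (dt u x t - dt v x t))) (at t within ?I)"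
    proof (rule leibniz_rule_field_derivative)
      show "((\<lambda>t. (u x t - v x t)\<^sup>2) has_field_derivative 2 * (u x t - v x t) * (dt u x t - dt v x t)) (at t within ?I)"
        if "t \<in> ?I" for x t
      proof (rule has_field_derivative_at_within)
        show "((\<lambda>t. (u x t - v x t)\<^sup>2) has_field_derivative 2 * (u x t - v x t) * (dt u x t - dt v x t)) (at t)"
          using DERIV_power[OF DERIV_diff[OF sol(3)[OF u that, of x] sol(3)[OF v that, of x]], of 2]
          by (simp add: algebra_simps)
      qed
      show "(\<lambda>x. (u x t - v x t)\<^sup>2) integrable_on cbox 0 (2 * pi)" if "t \<in> ?I" for t
        by (intro integrable_continuous continuous_intros contx that)
      show "continuous_on (?I \<times> cbox 0 (2 * pi)) (\<lambda>(t, x). 2 * (u x t - v x t) * (dt u x t - dt v x t))"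
        unfolding case_prod_unfold by (intro continuous_intros cont)
    qed (use t in auto)
    then show ?thesis
      unfolding E_def[abs_def] E'_def using t by (simp add: at_within_open[OF t])
  qed
  \<comment> \<open>Restricting to the compact interval |s| \<le> |t| inside the open life span
    makes u_x + v_x bounded; the bound \<open>K\<close> may depend on \<open>t\<close>.\<close>
  define \<tau> where "\<tau> = \<bar>t\<bar>"
  have \<tau>: "s \<in> ?I" if "\<bar>s\<bar> \<le> \<tau>" for s
    using that t by (auto simp: \<tau>_def)
  have "compact (({- \<tau>..\<tau>} \<times> {0..2 * pi}) :: (real \<times> real) set)"
    by (intro compact_Times) auto
  moreover have "continuous_on ({- \<tau>..\<tau>} \<times> {0..2 * pi}) (\<lambda>z. dx u (snd z) (fst z) + dx v (snd z) (fst z))"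
    by (rule continuous_on_subset[of "?I \<times> {0..2 * pi}"], intro continuous_intros cont)
       (use \<tau> in \<open>auto simp: abs_le_iff\<close>)
  ultimately have "compact ((\<lambda>z. dx u (snd z) (fst z) + dx v (snd z) (fst z)) ` ({- \<tau>..\<tau>} \<times> {0..2 * pi}))"
    by (intro compact_continuous_image)
  then obtain K where K: "\<And>z. z \<in> {- \<tau>..\<tau>} \<times> {0..2 * pi} \<Longrightarrow> norm (dx u (snd z) (fst z) + dx v (snd z) (fst z)) \<le> K"
    by (meson compact_imp_bounded bounded_iff imageI)
  have le: "\<bar>E' s\<bar> \<le> 3 / 4 * K * E s" if s: "\<bar>s\<bar> \<le> \<tau>" for s
  proof -
    let ?A = "\<lambda>x. 2 * (u x s - v x s) * (dt u x s - dt v x s)"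
    let ?B = "\<lambda>x. 3 / 4 * ((u x s - v x s)\<^sup>2 * (dx u x s + dx v x s))"
    note I = \<tau>[OF s]
    have Q: "((\<lambda>x. ?A x + ?B x) has_integral 0) {0..2 * pi}"
      by (rule FW_energy_identity) (intro sol(1,2) dx_cont eq u v I)+
    have A: "?A integrable_on {0..2 * pi}"
      by (intro integrable_continuous_interval continuous_intros contx I)
    have B: "?B integrable_on {0..2 * pi}"
      by (intro integrable_continuous_interval continuous_intros contx I) auto
    have C: "(\<lambda>x. 3 / 4 * K * (u x s - v x s)\<^sup>2) integrable_on {0..2 * pi}"
      by (intro integrable_continuous_interval continuous_intros contx I) auto
    have "E' s + integral {0..2 * pi} ?B = 0"
      unfolding E'_def using Henstock_Kurzweil_Integration.integral_add[OF A B] integral_unique[OF Q] by simp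
    then have "\<bar>E' s\<bar> = norm (integral {0..2 * pi} ?B)"
      by simp
    also have "\<dots> \<le> integral {0..2 * pi} (\<lambda>x. 3 / 4 * K * (u x s - v x s)\<^sup>2)"
    proof (rule integral_norm_bound_integral[OF B C])
      fix x assume x: "x \<in> {0..2 * pi}"
      have "\<bar>dx u x s + dx v x s\<bar> \<le> K"
        using K[of "(s, x)"] s x by (auto simp: abs_le_iff)
      then have "(u x s - v x s)\<^sup>2 * \<bar>dx u x s + dx v x s\<bar> \<le> (u x s - v x s)\<^sup>2 * K"
        by (rule mult_left_mono) simp
      then show "norm (?B x) \<le> 3 / 4 * K * (u x s - v x s)\<^sup>2"
        by (simp add: abs_mult mult.commute)
    qed
    also have "\<dots> = 3 / 4 * K * E s"
      unfolding E_def by (rule integral_mult_right)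
    finally show ?thesis .
  qed
  have "u x 0 = v x 0" for x
    using u v by (simp add: analytic_FW_solution_def)
  then have "E 0 = 0"
    by (simp add: E_def)
  then have "E t \<le> 0"
    using gronwall_zero[of \<tau> E E' "3 / 4 * K" t] derE \<tau> le unfolding \<tau>_def by blast
  moreover have c: "continuous_on {0..2 * pi} (\<lambda>x. (u x t - v x t)\<^sup>2)"
    by (intro continuous_intros contx t)
  then have "E t \<ge> 0"
    unfolding E_def by (intro integral_nonneg integrable_continuous_interval) auto
  ultimately have "E t = 0" by simp
  then have zero: "u y t = v y t" if "y \<in> {0..2 * pi}" for y
    using integral_eq_0_iff[OF c] that unfolding E_def by auto
  have "periodic_2pi (\<lambda>x. u x t - v x t)"
    using sol(1)[OF u t] sol(1)[OF v t] by (simp add: periodic_2pi_def)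
  then obtain y where "0 \<le> y" "y \<le> 2 * pi" "u y t - v y t = u x t - v x t"
    by (rule periodic_2pi_reduce)
  then show ?thesis using zero[of y] by simp
qed

text \<open>Solutions are total functions whose values for |t| \<ge> \<epsilon> are unconstrained,
  so agreement is asserted on the open strip only.\<close>

theorem theorem1p4:
  fixes u0 :: "real \<Rightarrow> real"
  assumes "periodic_2pi u0"
    and "\<And>x. real_analytic_at u0 x"
  shows "\<exists>\<epsilon>>0. \<exists>u. analytic_FW_solution u0 \<epsilon> u \<and>
           (\<forall>v. analytic_FW_solution u0 \<epsilon> v \<longrightarrow>
              (\<forall>x. \<forall>t\<in>{-\<epsilon><..<\<epsilon>}. v x t = u x t))"
  using analytic_FW_solution_exists[OF assms] analytic_FW_solution_unique by blast

end
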